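(* Let $H$ be a finite group, let $\alpha,\beta$ be integers with $0\le\alpha<\beta$, and let $\Lambda\subseteq\mathbb N$ and $M\subseteq\mathbb N_0$. For $n\ge 0$ let $s_\Lambda^M(n)$ be the number of $(\Lambda,M)$-admissible solutions $X=(f,\tau)$ of the equation $X^\alpha=X^\beta$ in $H\wr T_n$ (where $(\Lambda,M)$-admissibility refers to the transformation $\tau$). Then $$\sum_{n\ge0}s_\Lambda^M(n)\,\frac{z^n}{n!}=e_M\bigg(\frac1{|H|}\sum_{\gamma\mid\beta-\alpha}\gamma^{-1}\,\iota_H\big(\tfrac{\beta-\alpha}{\gamma}\big)\Big(\big(\Delta_\alpha(|H|z)\big)^\gamma\Big)_\Lambda\bigg),$$ as formal power series in $z$.
   Context: $T_n$ is the full transformation semigroup on $[n]=\{1,\dots,n\}$ (all maps $[n]\to[n]$), with product $(\tau_1\cdot\tau_2)(j)=\tau_2(\tau_1(j))$. For a finite group $H$, the wreath product $H\wr T_n$ is the set of pairs $(f,\tau)$ with $f:[n]\to H$, $\tau\in T_n$, with multiplication $(f_1,\tau_1)(f_2,\tau_2)=(f,\tau_1\cdot\tau_2)$, $f(j)=f_1(j)f_2(\tau_1(j))$; its identity is $(\mathbf 1,\mathrm{id})$ and $X^0$ is this identity. For $\tau\in T_n$, its components are the vertex sets of the connected components of $\tau$ viewed as a directed graph on $[n]$ (equivalently, classes of $j_1\sim j_2$ iff $\tau^k(j_1)=\tau^l(j_2)$ for some $k,l\ge0$); the decomposition numbers are the sizes of the components and the decomposition length is their number. $\tau$ is $(\Lambda,M)$-admissible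 if all its decomposition numbers lie in $\Lambda$ and its decomposition length lies in $M$. $\iota_H(m)$ is the number of $x\in H$ with $x^m=1$. For a power series $f(z)=\sum_k f_kz^k$ and $K\subseteq\mathbb N_0$, $(f(z))_K:=\sum_{k\in K}f_kz^k$; $e_M(z):=(\exp(z))_M$. The functions $\Delta_\alpha$ are defined by $\Delta_0(z)=z$ and $\Delta_\alpha(z)=z\exp(\Delta_{\alpha-1}(z))$ for $\alpha\ge1$. *)

theory Defs
  imports
    "HOL-Algebra.Group"
    "HOL-Library.FuncSet"
    "HOL-Computational_Algebra.Formal_Power_Series"
begin

text \<open>
  Maps on \<open>{1..n}\<close> are taken to be extensional (value \<open>undefined\<close> outside \<open>{1..n}\<close>), so that
  distinct elements of the carriers below are distinct maps on \<open>{1..n}\<close> and may be counted.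
  Products of transformations are read from left to right.
\<close>

definition full_transf :: "nat \<Rightarrow> (nat \<Rightarrow> nat) monoid" where
  "full_transf n =
    \<lparr>carrier = {1..n} \<rightarrow>\<^sub>E {1..n},
     monoid.mult = (\<lambda>\<tau>\<^sub>1 \<tau>\<^sub>2. \<lambda>j\<in>{1..n}. \<tau>\<^sub>2 (\<tau>\<^sub>1 j)),
     monoid.one = (\<lambda>j\<in>{1..n}. j)\<rparr>"

definition wreath :: "('a, 'b) monoid_scheme \<Rightarrow> nat \<Rightarrow> ((nat \<Rightarrow> 'a) \<times> (nat \<Rightarrow> nat)) monoid" where
  "wreath H n =
    \<lparr>carrier = ({1..n} \<rightarrow>\<^sub>E carrier H) \<times> carrier (full_transf n),
     monoid.mult = (\<lambda>(f\<^sub>1, \<tau>\<^sub>1) (f\<^sub>2, \<tau>\<^sub>2).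
       (\<lambda>j\<in>{1..n}. f\<^sub>1 j \<otimes>\<^bsub>H\<^esub> f\<^sub>2 (\<tau>\<^sub>1 j), \<tau>\<^sub>1 \<otimes>\<^bsub>full_transf n\<^esub> \<tau>\<^sub>2)),
     monoid.one = (\<lambda>j\<in>{1..n}. \<one>\<^bsub>H\<^esub>, \<one>\<^bsub>full_transf n\<^esub>)\<rparr>"

text \<open>
  Connectedness in the digraph with edges \<open>i \<rightarrow> \<tau> i\<close> is weak connectedness, i.e. the equivalence
  relation generated by the edges.
\<close>

definition transf_components :: "nat \<Rightarrow> (nat \<Rightarrow> nat) \<Rightarrow> nat set set" where
  "transf_components n \<tau> =
    {1..n} // {(i, j). i \<in> {1..n} \<and> j \<in> {1..n} \<and> equivclp (\<lambda>a b. a \<in> {1..n} \<and> b = \<tau> a) i j}"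

definition admissible :: "nat set \<Rightarrow> nat set \<Rightarrow> nat \<Rightarrow> (nat \<Rightarrow> nat) \<Rightarrow> bool" where
  "admissible \<Lambda> M n \<tau> \<longleftrightarrow>
    (\<forall>C \<in> transf_components n \<tau>. card C \<in> \<Lambda>) \<and> card (transf_components n \<tau>) \<in> M"

definition num_solutions ::
    "('a, 'b) monoid_scheme \<Rightarrow> nat \<Rightarrow> nat \<Rightarrow> nat set \<Rightarrow> nat set \<Rightarrow> nat \<Rightarrow> nat" where
  "num_solutions H \<alpha> \<beta> \<Lambda> M n =
    card {X \<in> carrier (wreath H n).
      X [^]\<^bsub>wreath H n\<^esub> \<alpha> = X [^]\<^bsub>wreath H n\<^esub> \<beta> \<and> admissible \<Lambda> M n (snd X)}"

definition iota :: "('a, 'b) monoid_scheme \<Rightarrow> nat \<Rightarrow> nat" where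
  "iota H m = card {x \<in> carrier H. x [^]\<^bsub>H\<^esub> m = \<one>\<^bsub>H\<^esub>}"

definition fps_restrict :: "'a::zero fps \<Rightarrow> nat set \<Rightarrow> 'a fps" where
  "fps_restrict f K = Abs_fps (\<lambda>k. if k \<in> K then fps_nth f k else 0)"

definition exp_restrict :: "nat set \<Rightarrow> rat fps" where
  "exp_restrict M = fps_restrict (fps_exp 1) M"

primrec Delta :: "nat \<Rightarrow> rat fps" where
  "Delta 0 = fps_X"
| "Delta (Suc \<alpha>) = fps_X * (fps_exp 1 oo Delta \<alpha>)"

text \<open>
  \<^const>\<open>fps_compose\<close> is substitution only if the inner series has no constant term;
  this lemma guarantees it for every composition with a \<open>Delta\<close> series.
\<close>

lemma Delta_nth_0 [simp]: "fps_nth (Delta \<alpha>) 0 = 0"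
  by (cases \<alpha>) simp_all

lemma monoid_full_transf: "monoid (full_transf n)"
  by (unfold_locales) (auto simp: full_transf_def fun_eq_iff PiE_iff extensional_def)

lemma monoid_wreath:
  assumes "monoid H"
  shows "monoid (wreath H n)"
proof -
  interpret monoid H by fact
  show ?thesis
    by (unfold_locales)
      (auto simp: wreath_def full_transf_def fun_eq_iff PiE_iff extensional_def m_assoc)
qed

lemma equivclp_transf_iff:
  assumes "\<tau> \<in> {1..n} \<rightarrow> {1..n}" and "i \<in> {1..n}" and "j \<in> {1..n}"
  shows "equivclp (\<lambda>a b. a \<in> {1..n} \<and> b = \<tau> a) i j \<longleftrightarrow> (\<exists>k l. (\<tau> ^^ k) i = (\<tau> ^^ l) j)"
    (is "equivclp ?E i j \<longleftrightarrow> ?R i j")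
proof
  assume "equivclp ?E i j"
  then show "?R i j"
  proof (induction rule: equivclp_induct)
    case base
    show ?case by blast
  next
    case (step y z)
    from step.IH obtain k l where kl: "(\<tau> ^^ k) i = (\<tau> ^^ l) y" by blast
    from step.hyps(2) show ?case
    proof
      assume "?E y z"
      then have "(\<tau> ^^ Suc k) i = (\<tau> ^^ l) z"
        using kl by (simp add: funpow_swap1)
      then show ?thesis by blast
    next
      assume "?E z y"
      then have "(\<tau> ^^ k) i = (\<tau> ^^ Suc l) z"
        using kl by (simp add: funpow_swap1)
      then show ?thesis by blast
    qed
  qed
next
  have path: "equivclp ?E a ((\<tau> ^^ k) a) \<and> (\<tau> ^^ k) a \<in> {1..n}" if "a \<in> {1..n}" for a k
  proof (induction k)
    case 0
    show ?case using that by simp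
  next
    case (Suc k)
    then have "?E ((\<tau> ^^ k) a) ((\<tau> ^^ Suc k) a)" by simp
    then have "equivclp ?E a ((\<tau> ^^ Suc k) a)"
      using Suc by (blast intro: equivclp_into_equivclp)
    moreover have "(\<tau> ^^ Suc k) a \<in> {1..n}"
      using Suc assms(1) by (auto simp: Pi_iff)
    ultimately show ?case by blast
  qed
  assume "?R i j"
  then show "equivclp ?E i j"
    using path[OF assms(2)] path[OF assms(3)] by (metis (no_types, lifting) equivclp_sym equivclp_trans)
qed

end

theory Submission
  imports Defs "HOL-Combinatorics.Multiset_Permutations"
begin

text \<open>
  The element \<open>X = (f, \<tau>)\<close> solves \<open>X\<^sup>\<alpha> = X\<^sup>\<beta>\<close> iff every point reaches a cycle of \<open>\<tau>\<close> within \<open>\<alpha>\<close> steps,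
  the length \<open>\<gamma>\<close> of each cycle divides \<open>\<beta> - \<alpha>\<close>, and the product of \<open>f\<close> around that cycle has order
  dividing \<open>(\<beta> - \<alpha>) / \<gamma>\<close>. Write \<open>h = |H|\<close>. Stripping the first level of a forest shows that the labelled forests
  of height at most \<open>\<alpha>\<close> over \<open>r\<close> roots have generating function \<open>\<Delta>\<^sub>\<alpha>(hz)\<^sup>r / (hz)\<^sup>r\<close>. A cycle with \<open>\<gamma>\<close>
  points carries \<open>(\<gamma> - 1)! h\<^bsup>\<gamma> - 1\<^esup> \<iota>((\<beta> - \<alpha>) / \<gamma>)\<close> structures, which gives the series \<open>C\<close> of connected
  solutions. Marking one component of a solution with \<open>k\<close> components yields \<open>k S\<^sub>k = C S\<^bsub>k-1\<^esub>\<close>, so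
  \<open>S\<^sub>k = C\<^sup>k / k!\<close>.

  A pair \<open>(f, \<tau>)\<close> is represented by the single map \<open>g x = (f x, \<tau> x)\<close> on an arbitrary finite set, so that
  decompositions of the ground set are restrictions of one function.
\<close>

section \<open>Counting by subsets, by fibres and by independent restrictions\<close>

text \<open>The recursions below sum over subsets, but the summands depend only on their sizes.
  Grouping by size produces the binomial convolution that multiplies exponential generating
  functions.\<close>

lemma sum_Pow_card:
  fixes \<phi> :: "nat \<Rightarrow> 'b::semiring_1"
  assumes "finite A"
  shows "(\<Sum>B\<in>Pow A. \<phi> (card B)) = (\<Sum>b\<le>card A. of_nat (card A choose b) * \<phi> b)"
proof -
  have "(\<Sum>B\<in>Pow A. \<phi> (card B)) = (\<Sum>b\<le>card A. \<Sum>B | B \<in> Pow A \<and> card B = b. \<phi> (card B))"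
    by (rule sum.group [symmetric]) (use assms in \<open>auto intro: card_mono\<close>)
  also have "\<dots> = (\<Sum>b\<le>card A. of_nat (card A choose b) * \<phi> b)"
    using assms by (intro sum.cong) (auto simp: n_subsets)
  finally show ?thesis .
qed

lemma card_eq_sum_fibres:
  assumes "finite S" "finite T" "f ` S \<subseteq> T"
  shows "card S = (\<Sum>t\<in>T. card {s\<in>S. f s = t})"
  using sum.group [OF assms, of "\<lambda>_. 1::nat"] by simp

text \<open>An extensional map on \<open>A\<close> is the same as a pair of extensional maps on
  \<open>B\<close> and \<open>A - B\<close>. When membership in \<open>S\<close> splits into one
  condition on each piece, the count factors. Each recursion below applies this to the maps with a
  prescribed subset \<open>B\<close>.\<close>

lemma card_extensional_split:
  assumes "B \<subseteq> A"
    and ext: "S \<subseteq> extensional A" "S1 \<subseteq> extensional B" "S2 \<subseteq> extensional (A - B)"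
    and iff: "\<And>g. g \<in> extensional A \<Longrightarrow> g \<in> S \<longleftrightarrow> restrict g B \<in> S1 \<and> restrict g (A - B) \<in> S2"
  shows "card S = card S1 * card S2"
proof -
  let ?m = "\<lambda>(u, v). \<lambda>x\<in>A. if x \<in> B then u x else v x"
  have "bij_betw (\<lambda>g. (restrict g B, restrict g (A - B))) S (S1 \<times> S2)"
  proof (rule bij_betw_byWitness [where f' = ?m])
    show "\<forall>g\<in>S. ?m (restrict g B, restrict g (A - B)) = g"
      using ext(1) by (auto simp: fun_eq_iff extensional_def)
    have *: "restrict (?m (u, v)) B = u" "restrict (?m (u, v)) (A - B) = v"
      if "u \<in> S1" "v \<in> S2" for u v
    proof -
      have "u \<in> extensional B" "v \<in> extensional (A - B)" using that ext by auto
      then show "restrict (?m (u, v)) B = u" "restrict (?m (u, v)) (A - B) = v"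
        using \<open>B \<subseteq> A\<close> by (auto simp: fun_eq_iff extensional_def)
    qed
    then show "\<forall>p\<in>S1 \<times> S2. (restrict (?m p) B, restrict (?m p) (A - B)) = p"
      by auto
    show "(\<lambda>g. (restrict g B, restrict g (A - B))) ` S \<subseteq> S1 \<times> S2"
      using iff ext(1) by auto
    show "?m ` (S1 \<times> S2) \<subseteq> S"
    proof
      fix g assume "g \<in> ?m ` (S1 \<times> S2)"
      then obtain u v where uv: "u \<in> S1" "v \<in> S2" "g = ?m (u, v)" by auto
      then show "g \<in> S" using iff [of g] * [OF uv(1,2)] by (metis case_prod_conv restrict_extensional)
    qed
  qed
  then show ?thesis
    by (simp add: bij_betw_same_card card_cartesian_product)
qed

section \<open>Iterates of a map and products of labels along its paths\<close>

definition tgt :: "('v \<Rightarrow> 'a \<times> 'v) \<Rightarrow> 'v \<Rightarrow> 'v" where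
  "tgt g x = snd (g x)"

text \<open>This is the \<open>H\<close>-coordinate at \<open>x\<close> of the \<open>k\<close>-th
  power in the wreath product, see \<open>wreath_pow\<close>.\<close>

primrec path_prod :: "('a, 'b) monoid_scheme \<Rightarrow> ('v \<Rightarrow> 'a \<times> 'v) \<Rightarrow> nat \<Rightarrow> 'v \<Rightarrow> 'a" where
  "path_prod H g 0 x = \<one>\<^bsub>H\<^esub>"
| "path_prod H g (Suc k) x = fst (g x) \<otimes>\<^bsub>H\<^esub> path_prod H g k (tgt g x)"

lemma tgt_funpow_closed:
  assumes "\<And>x. x \<in> B \<Longrightarrow> tgt g x \<in> B" "x \<in> B"
  shows "(tgt g ^^ k) x \<in> B"
  using assms by (induction k) auto

text \<open>Lets iterates be computed in the restriction of a map to a closed set.\<close>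

lemma tgt_funpow_cong:
  assumes "\<And>x. x \<in> B \<Longrightarrow> tgt g x \<in> B" "\<And>x. x \<in> B \<Longrightarrow> g' x = g x" "x \<in> B"
  shows "(tgt g' ^^ k) x = (tgt g ^^ k) x"
  using tgt_funpow_closed [OF assms(1) assms(3)] assms(2) by (induction k) (auto simp: tgt_def)

lemma path_prod_cong:
  assumes "\<And>x. x \<in> B \<Longrightarrow> tgt g x \<in> B" "\<And>x. x \<in> B \<Longrightarrow> g' x = g x" "x \<in> B"
  shows "path_prod H g' k x = path_prod H g k x"
  using assms(3)
proof (induction k arbitrary: x)
  case (Suc k)
  have "tgt g' x = tgt g x" using Suc.prems assms(2) by (simp add: tgt_def)
  then show ?case using Suc assms(1,2) by simp
qed simp

lemma tgt_funpow_period: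
  assumes "(tgt g ^^ m) x = x"
  shows "(tgt g ^^ (m * k)) x = x"
  using assms by (induction k) (simp_all add: funpow_add)

lemma (in group) path_prod_closed [intro]:
  assumes "\<And>x. x \<in> A \<Longrightarrow> g x \<in> carrier G \<times> A" "x \<in> A"
  shows "path_prod G g k x \<in> carrier G"
  using assms(2)
proof (induction k arbitrary: x)
  case (Suc k)
  then show ?case using assms(1) [of x] by (auto simp: tgt_def mem_Times_iff)
qed simp

lemma (in group) path_prod_add:
  assumes "\<And>x. x \<in> A \<Longrightarrow> g x \<in> carrier G \<times> A" "x \<in> A"
  shows "path_prod G g (k + l) x = path_prod G g k x \<otimes> path_prod G g l ((tgt g ^^ k) x)"
  using assms(2)
proof (induction k arbitrary: x)
  case 0
  then show ?case using path_prod_closed [OF assms(1)] by simp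
next
  case (Suc k)
  have t: "tgt g y \<in> A" if "y \<in> A" for y using assms(1) that by (simp add: tgt_def mem_Times_iff)
  have "fst (g x) \<in> carrier G" using assms(1) [of x] Suc.prems by (auto simp: mem_Times_iff)
  moreover have "(tgt g ^^ k) (tgt g x) \<in> A" using Suc.prems t by (intro tgt_funpow_closed)
  moreover have "path_prod G g i y \<in> carrier G" if "y \<in> A" for i y
    using path_prod_closed [OF assms(1) that] .
  ultimately show ?case
    using Suc.IH [OF t [OF Suc.prems]] Suc.prems t by (simp add: funpow_swap1 m_assoc)
qed

section \<open>Forests\<close>

text \<open>The recursion stops at the first visit to \<open>R\<close>, so the values of the map on
  \<open>R\<close>, where a forest is undefined, have no influence.\<close>

primrec reaches :: "('v \<Rightarrow> 'a \<times> 'v) \<Rightarrow> 'v set \<Rightarrow> nat \<Rightarrow> 'v \<Rightarrow> bool" where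
  "reaches g R 0 x \<longleftrightarrow> x \<in> R"
| "reaches g R (Suc a) x \<longleftrightarrow> x \<in> R \<or> reaches g R a (tgt g x)"

text \<open>\<open>R\<close> holds the roots and \<open>A\<close> the remaining vertices. Only the
  latter carry an edge and a label, which leaves the roots free to be joined by a cycle
  later.\<close>

definition forests :: "('a, 'b) monoid_scheme \<Rightarrow> nat \<Rightarrow> 'v set \<Rightarrow> 'v set \<Rightarrow> ('v \<Rightarrow> 'a \<times> 'v) set" where
  "forests H a A R = {g \<in> A \<rightarrow>\<^sub>E carrier H \<times> (A \<union> R). \<forall>x\<in>A. reaches g R a x}"

lemma reaches_iff: "reaches g R a x \<longleftrightarrow> (\<exists>k\<le>a. (tgt g ^^ k) x \<in> R)"
proof (induction a arbitrary: x)
  case (Suc a)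
  have "(\<exists>k\<le>Suc a. (tgt g ^^ k) x \<in> R) \<longleftrightarrow> x \<in> R \<or> (\<exists>k\<le>a. (tgt g ^^ Suc k) x \<in> R)"
    by (metis Suc_le_mono funpow_0 not0_implies_Suc zero_le)
  then show ?case by (simp add: Suc funpow_swap1)
qed simp

lemma reaches_cong:
  assumes "\<And>x. x \<in> A \<Longrightarrow> tgt g x \<in> A \<union> R" "\<And>x. x \<in> A \<Longrightarrow> g' x = g x" "x \<in> A \<union> R"
  shows "reaches g' R a x \<longleftrightarrow> reaches g R a x"
  using assms(3)
proof (induction a arbitrary: x)
  case (Suc a)
  show ?case
  proof (cases "x \<in> R")
    case False
    then have "x \<in> A" using Suc.prems by auto
    then have "tgt g' x = tgt g x" "tgt g x \<in> A \<union> R" using assms by (auto simp: tgt_def)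
    then show ?thesis using Suc.IH by simp
  qed simp
qed simp

text \<open>A path that starts in \<open>A\<close> can enter \<open>R\<close> only from a point
  whose target lies in \<open>R\<close>. Taking these points as the new roots shortens the path by
  one step.\<close>

lemma reaches_Suc_iff:
  assumes "\<And>x. x \<in> A \<Longrightarrow> tgt g x \<in> A \<union> R" "A \<inter> R = {}" "x \<in> A"
  shows "reaches g R (Suc a) x \<longleftrightarrow> reaches g {x\<in>A. tgt g x \<in> R} a x"
  using assms(3)
proof (induction a arbitrary: x)
  case 0
  then show ?case using assms(2) by auto
next
  case (Suc a)
  have "x \<notin> R" using Suc.prems assms(2) by auto
  show ?case
  proof (cases "tgt g x \<in> R")
    case True
    then show ?thesis using Suc.prems by simp
  next
    case False
    then have "tgt g x \<in> A" using assms(1) Suc.prems by auto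
    from Suc.IH [OF this] show ?thesis using False \<open>x \<notin> R\<close> by simp
  qed
qed

text \<open>Classify forests by the set \<open>B\<close> of children of the roots. Each child
  chooses its label and its root freely, and the other vertices form a forest of height at most
  \<open>a\<close> over the roots \<open>B\<close>.\<close>

lemma card_forests_Suc:
  assumes "finite A" "finite R" "A \<inter> R = {}" "finite (carrier H)"
  shows "card (forests H (Suc a) A R) =
    (\<Sum>B\<in>Pow A. (card (carrier H) * card R) ^ card B * card (forests H a (A - B) B))"
proof -
  let ?D = "\<lambda>g. {x\<in>A. tgt g x \<in> R}"
  have fin: "finite (forests H (Suc a) A R)"
    unfolding forests_def using assms
    by (intro finite_subset [OF _ finite_PiE [of A "\<lambda>_. carrier H \<times> (A \<union> R)"]]) auto
  have "card (forests H (Suc a) A R) = (\<Sum>B\<in>Pow A. card {g \<in> forests H (Suc a) A R. ?D g = B})"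
    using fin assms by (intro card_eq_sum_fibres) auto
  also have "\<dots> = (\<Sum>B\<in>Pow A. card (B \<rightarrow>\<^sub>E carrier H \<times> R) * card (forests H a (A - B) B))"
  proof (intro sum.cong refl card_extensional_split)
    fix B assume "B \<in> Pow A"
    then show B: "B \<subseteq> A" by simp
    fix g :: "'a \<Rightarrow> 'b \<times> 'a" assume g: "g \<in> extensional A"
    let ?u = "restrict g B" and ?v = "restrict g (A - B)"
    show "g \<in> {g \<in> forests H (Suc a) A R. ?D g = B} \<longleftrightarrow>
      ?u \<in> B \<rightarrow>\<^sub>E carrier H \<times> R \<and> ?v \<in> forests H a (A - B) B" (is "?l \<longleftrightarrow> ?r")
    proof
      assume ?l
      then have gA: "\<And>x. x \<in> A \<Longrightarrow> g x \<in> carrier H \<times> (A \<union> R)" "?D g = B"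
        and r: "\<And>x. x \<in> A \<Longrightarrow> reaches g R (Suc a) x"
        by (auto simp: forests_def)
      then have t: "\<And>x. x \<in> A \<Longrightarrow> tgt g x \<in> A \<union> R" by (simp add: tgt_def mem_Times_iff)
      have t': "\<And>x. x \<in> A - B \<Longrightarrow> tgt g x \<in> (A - B) \<union> B" using t gA(2) B by blast
      have "reaches ?v B a x" if "x \<in> A - B" for x
        using reaches_Suc_iff [OF t assms(3), of x a] r [of x] that gA(2)
          reaches_cong [of "A - B" g B ?v x a, OF t'] by auto
      then have "?v \<in> forests H a (A - B) B"
        using gA t' by (auto simp: forests_def tgt_def mem_Times_iff)
      moreover have "?u \<in> B \<rightarrow>\<^sub>E carrier H \<times> R"
        using gA B by (fastforce simp: tgt_def mem_Times_iff)
      ultimately show ?r by simp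
    next
      assume ?r
      then have u: "\<And>x. x \<in> B \<Longrightarrow> g x \<in> carrier H \<times> R"
        and v: "\<And>x. x \<in> A - B \<Longrightarrow> g x \<in> carrier H \<times> ((A - B) \<union> B)"
        and r: "\<And>x. x \<in> A - B \<Longrightarrow> reaches ?v B a x"
        by (fastforce simp: forests_def PiE_iff)+
      have gA: "\<And>x. x \<in> A \<Longrightarrow> g x \<in> carrier H \<times> (A \<union> R)"
        using u v B by (fastforce simp: mem_Times_iff)
      then have t: "\<And>x. x \<in> A \<Longrightarrow> tgt g x \<in> A \<union> R" by (simp add: tgt_def mem_Times_iff)
      have t': "\<And>x. x \<in> A - B \<Longrightarrow> tgt g x \<in> (A - B) \<union> B" using v by (simp add: tgt_def mem_Times_iff)
      have D: "?D g = B" 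
        using u t' B assms(3) by (fastforce simp: tgt_def mem_Times_iff)
      have "reaches g R (Suc a) x" if "x \<in> A" for x
      proof -
        have "reaches g B a x"
        proof (cases "x \<in> B")
          case True
          then show ?thesis by (cases a) auto
        next
          case False
          then show ?thesis using that r [of x] reaches_cong [of "A - B" g B ?v x a, OF t'] by auto
        qed
        then show ?thesis using reaches_Suc_iff [OF t assms(3) that, of a] D by simp
      qed
      then show ?l using gA g D by (auto simp: forests_def PiE_iff)
    qed
  qed (auto simp: forests_def PiE_iff)
  also have "\<dots> = (\<Sum>B\<in>Pow A. (card (carrier H) * card R) ^ card B * card (forests H a (A - B) B))"
    using finite_subset [OF _ assms(1)] by (intro sum.cong) (simp_all add: card_PiE card_cartesian_product)
  finally show ?thesis .
qed

section \<open>Generating functions of forests\<close>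

abbreviation scaled_Delta :: "nat \<Rightarrow> nat \<Rightarrow> rat fps" where
  "scaled_Delta h a \<equiv> Delta a oo (fps_const (of_nat h) * fps_X)"

text \<open>The quotient of \<open>scaled_Delta h a ^ r\<close> by the \<open>r\<close>-th power of
  \<open>hz\<close>, written as an exponential so that no division of power series is
  needed.\<close>

primrec forest_fps :: "nat \<Rightarrow> nat \<Rightarrow> nat \<Rightarrow> rat fps" where
  "forest_fps h 0 r = 1"
| "forest_fps h (Suc a) r = fps_exp (of_nat r) oo scaled_Delta h a"

text \<open>For positive height this is the \<open>r\<close>-th power of the defining recursion of
  \<open>Delta\<close> at \<open>hz\<close>; at height 0 both sides are the \<open>r\<close>-th
  power of \<open>hz\<close>.\<close>

lemma scaled_Delta_power:
  "scaled_Delta h a ^ r = (fps_const (of_nat h) * fps_X) ^ r * forest_fps h a r"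
proof (cases a)
  case 0
  then show ?thesis by simp
next
  case (Suc b)
  have "scaled_Delta h a = (fps_const (of_nat h) * fps_X) * (fps_exp 1 oo scaled_Delta h b)"
    unfolding Suc by (simp add: fps_compose_mult_distrib fps_compose_assoc)
  moreover have "(fps_exp 1 oo scaled_Delta h b) ^ r = forest_fps h a r"
    unfolding Suc by (simp add: fps_compose_power fps_exp_power_mult)
  ultimately show ?thesis by (simp add: power_mult_distrib)
qed

lemma scaled_Delta_power_nth:
  "fps_nth (scaled_Delta h a ^ r) n =
    (if n < r then 0 else of_nat h ^ r * fps_nth (forest_fps h a r) (n - r))"
  by (simp add: scaled_Delta_power power_mult_distrib mult.assoc fps_X_power_mult_nth
      del: fps_const_mult)

text \<open>Induction on the height. With \<open>b\<close> children of the roots, the binomial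
  coefficient and \<open>fact (n - b)\<close> combine to \<open>fact n / fact b\<close>, and the
  \<open>b\<close>-th power of \<open>h\<close> completes the forest coefficient to one of
  \<open>scaled_Delta h a ^ b\<close>. Summing \<open>r ^ b / fact b\<close> times these
  coefficients gives the exponential of \<open>r\<close> times
  \<open>scaled_Delta h a\<close>.\<close>

lemma card_forests:
  assumes "finite A" "finite R" "A \<inter> R = {}" "finite (carrier H)"
  shows "(of_nat (card (forests H a A R)) :: rat) =
    fact (card A) * fps_nth (forest_fps (card (carrier H)) a (card R)) (card A)"
  using assms(1-3)
proof (induction a arbitrary: A R)
  case 0
  show ?case
  proof (cases "A = {}")
    case True
    then have "forests H 0 A R = {\<lambda>_. undefined}" by (auto simp: forests_def)
    then show ?thesis using True by simp
  next
    case False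
    then have "forests H 0 A R = {}" using 0 by (auto simp: forests_def)
    then show ?thesis using False 0 by simp
  qed
next
  case (Suc a)
  let ?h = "card (carrier H)" and ?r = "card R" and ?n = "card A"
  let ?\<phi> = "\<lambda>b. (of_nat ?h * of_nat ?r) ^ b * (fact (?n - b) * fps_nth (forest_fps ?h a b) (?n - b)) :: rat"
  have "(of_nat (card (forests H (Suc a) A R)) :: rat) = (\<Sum>B\<in>Pow A. ?\<phi> (card B))"
    unfolding card_forests_Suc [OF Suc.prems assms(4)] of_nat_sum
  proof (rule sum.cong [OF refl])
    fix B assume "B \<in> Pow A"
    then have "finite B" "B \<subseteq> A" using Suc.prems finite_subset by auto
    then show "(of_nat ((?h * ?r) ^ card B * card (forests H a (A - B) B)) :: rat) = ?\<phi> (card B)"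
      using Suc.IH [of "A - B" B] Suc.prems by (auto simp: card_Diff_subset)
  qed
  also have "\<dots> = (\<Sum>b\<le>?n. of_nat (?n choose b) * ?\<phi> b)"
    by (rule sum_Pow_card [OF Suc.prems(1)])
  also have "\<dots> = (\<Sum>b\<le>?n. fact ?n * (of_nat ?r ^ b / fact b * fps_nth (scaled_Delta ?h a ^ b) ?n))"
  proof (rule sum.cong [OF refl])
    fix b assume "b \<in> {..?n}"
    then have "b \<le> ?n" by simp
    then show "of_nat (?n choose b) * ?\<phi> b =
        fact ?n * (of_nat ?r ^ b / fact b * fps_nth (scaled_Delta ?h a ^ b) ?n)"
      by (simp add: scaled_Delta_power_nth binomial_fact power_mult_distrib)
  qed
  also have "\<dots> = fact ?n * fps_nth (forest_fps ?h (Suc a) ?r) ?n"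
    by (simp add: fps_compose_nth sum_distrib_left atMost_atLeast0)
  finally show ?case .
qed

section \<open>Cycles\<close>

text \<open>The condition is put on walks of \<open>m\<close> steps rather than on one turn around
  the cycle, because this is how the equation supplies it with \<open>m\<close> equal to
  \<open>b - a\<close>. Transitivity together with \<open>R \<noteq> {}\<close> makes
  \<open>R\<close> exactly one cycle.\<close>

definition cycles :: "('a, 'b) monoid_scheme \<Rightarrow> nat \<Rightarrow> 'v set \<Rightarrow> ('v \<Rightarrow> 'a \<times> 'v) set" where
  "cycles H m R = {g \<in> R \<rightarrow>\<^sub>E carrier H \<times> R. R \<noteq> {} \<and>
    (\<forall>x\<in>R. \<forall>y\<in>R. \<exists>i. (tgt g ^^ i) x = y) \<and>
    (\<forall>x\<in>R. (tgt g ^^ m) x = x \<and> path_prod H g m x = \<one>\<^bsub>H\<^esub>)}"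

lemma cyclesD:
  assumes "g \<in> cycles H m R"
  shows "g \<in> extensional R" "\<And>x. x \<in> R \<Longrightarrow> g x \<in> carrier H \<times> R" "\<And>x. x \<in> R \<Longrightarrow> tgt g x \<in> R"
    "\<And>x y. \<lbrakk>x \<in> R; y \<in> R\<rbrakk> \<Longrightarrow> \<exists>i. (tgt g ^^ i) x = y"
    "\<And>x. x \<in> R \<Longrightarrow> (tgt g ^^ m) x = x" "\<And>x. x \<in> R \<Longrightarrow> path_prod H g m x = \<one>\<^bsub>H\<^esub>"
  using assms unfolding cycles_def by (auto simp: PiE_iff tgt_def mem_Times_iff)

text \<open>Let \<open>p\<close> be the least positive period of \<open>x\<close>. Minimality makes
  the first \<open>p\<close> iterates distinct, transitivity makes them exhaust \<open>R\<close>, so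
  \<open>p\<close> is the size of \<open>R\<close>; minimality also forces
  \<open>m mod p = 0\<close>.\<close>

lemma cycle_orbit:
  assumes g: "g \<in> cycles H m R" and "finite R" "x \<in> R" "0 < m"
  shows "bij_betw (\<lambda>i. (tgt g ^^ i) x) {..<card R} R" "(tgt g ^^ card R) x = x" "card R dvd m"
proof -
  define p where "p = (LEAST p. 0 < p \<and> (tgt g ^^ p) x = x)"
  have p: "0 < p" "(tgt g ^^ p) x = x"
    using LeastI [of "\<lambda>p. 0 < p \<and> (tgt g ^^ p) x = x" m] cyclesD(5) [OF g \<open>x \<in> R\<close>] \<open>0 < m\<close>
    unfolding p_def by auto
  have least: "\<not> (0 < q \<and> (tgt g ^^ q) x = x)" if "q < p" for q
    using not_less_Least that unfolding p_def by blast
  have "i = j" if "i < p" "j < p" "(tgt g ^^ i) x = (tgt g ^^ j) x" "i \<le> j" for i j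
  proof (rule ccontr)
    assume "i \<noteq> j"
    \<comment> \<open>Applying \<open>p - j\<close> further steps to both equal iterates closes the
      orbit on one side, and so yields a positive period smaller than \<open>p\<close> on the
      other.\<close>
    have "(tgt g ^^ (p - j + i)) x = (tgt g ^^ (p - j + j)) x"
      using that(3) by (simp only: funpow_add comp_def)
    also have "\<dots> = x" using that p by simp
    finally have "(tgt g ^^ (p - j + i)) x = x" .
    moreover have "p - j + i < p" "0 < p - j + i" using that \<open>i \<noteq> j\<close> by auto
    ultimately show False using least by blast
  qed
  then have inj: "inj_on (\<lambda>i. (tgt g ^^ i) x) {..<p}"
    by (auto simp: inj_on_def) (metis nle_le)
  have "(\<lambda>i. (tgt g ^^ i) x) ` {..<p} = R"
  proof (intro equalityI subsetI)
    fix y assume "y \<in> R"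
    then obtain i where "(tgt g ^^ i) x = y" using cyclesD(4) [OF g \<open>x \<in> R\<close>] by blast
    then have "y = (tgt g ^^ (i mod p)) x" using p by (simp add: funpow_mod_eq)
    then show "y \<in> (\<lambda>i. (tgt g ^^ i) x) ` {..<p}" using p by auto
  qed (use tgt_funpow_closed [OF cyclesD(3) [OF g]] \<open>x \<in> R\<close> in auto)
  with inj have bij: "bij_betw (\<lambda>i. (tgt g ^^ i) x) {..<p} R" by (simp add: bij_betw_def)
  then have pR: "p = card R" using bij_betw_same_card by fastforce
  show "bij_betw (\<lambda>i. (tgt g ^^ i) x) {..<card R} R" "(tgt g ^^ card R) x = x"
    using bij p pR by auto
  have "(tgt g ^^ (m mod p)) x = x" using p cyclesD(5) [OF g \<open>x \<in> R\<close>] by (simp add: funpow_mod_eq)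
  then have "m mod p = 0" using least [of "m mod p"] p by auto
  then show "card R dvd m" using pR by auto
qed

text \<open>Reduces the condition on a cycle to a condition on the list of labels read along
  it.\<close>

lemma path_prod_eq_foldr:
  "path_prod H g k x = foldr (\<otimes>\<^bsub>H\<^esub>) (map (\<lambda>i. fst (g ((tgt g ^^ i) x))) [0..<k]) \<one>\<^bsub>H\<^esub>"
proof (induction k arbitrary: x)
  case (Suc k)
  show ?case
    unfolding map_upt_Suc by (simp add: Suc funpow_swap1)
qed simp

context group
begin

lemma path_prod_period:
  assumes "\<And>x. x \<in> A \<Longrightarrow> g x \<in> carrier G \<times> A" "x \<in> A" "(tgt g ^^ p) x = x"
  shows "path_prod G g (p * k) x = path_prod G g p x [^] k"
proof (induction k)
  case (Suc k)
  have "path_prod G g (p * Suc k) x = path_prod G g (p * k + p) x" by (simp add: add.commute)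
  also have "\<dots> = path_prod G g (p * k) x \<otimes> path_prod G g p x"
    using path_prod_add [OF assms(1,2)] tgt_funpow_period [OF assms(3)] by simp
  finally show ?case using Suc by simp
qed simp

text \<open>The products along a closed path from two of its vertices are conjugate.\<close>

lemma path_prod_shift_one:
  assumes "\<And>x. x \<in> A \<Longrightarrow> g x \<in> carrier G \<times> A" "x \<in> A" "(tgt g ^^ m) x = x"
    and "path_prod G g m x = \<one>"
  shows "path_prod G g m ((tgt g ^^ k) x) = \<one>"
proof -
  have y: "(tgt g ^^ k) x \<in> A"
    using assms(1) by (intro tgt_funpow_closed) (auto simp: tgt_def mem_Times_iff assms(2))
  have "path_prod G g k x \<otimes> path_prod G g m ((tgt g ^^ k) x) = path_prod G g (m + k) x"
    using path_prod_add [OF assms(1,2)] by (simp add: add.commute)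
  also have "\<dots> = path_prod G g k x"
    using path_prod_add [OF assms(1,2), where k = m and l = k] assms(3,4) path_prod_closed [OF assms(1,2)] by simp
  finally show ?thesis
    using path_prod_closed [OF assms(1) y] path_prod_closed [OF assms(1,2)] by simp
qed

lemma foldr_mult_closed: "set hs \<subseteq> carrier G \<Longrightarrow> foldr (\<otimes>) hs \<one> \<in> carrier G"
  by (induction hs) auto

text \<open>The tail is arbitrary, and the product then determines the first entry by multiplication
  with the inverse of the product of the tail.\<close>

lemma card_lists_foldr_mult:
  assumes "finite (carrier G)" "S \<subseteq> carrier G"
  shows "card {hs. set hs \<subseteq> carrier G \<and> length hs = Suc d \<and> foldr (\<otimes>) hs \<one> \<in> S} =
    card S * card (carrier G) ^ d"
proof -
  let ?L = "{hs. set hs \<subseteq> carrier G \<and> length hs = Suc d \<and> foldr (\<otimes>) hs \<one> \<in> S}"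
  let ?T = "{hs. set hs \<subseteq> carrier G \<and> length hs = d}"
  have "bij_betw (\<lambda>hs. (foldr (\<otimes>) hs \<one>, tl hs)) ?L (S \<times> ?T)"
  proof (rule bij_betw_byWitness [where f' = "\<lambda>(y, t). (y \<otimes> inv (foldr (\<otimes>) t \<one>)) # t"])
    show "\<forall>hs\<in>?L. (\<lambda>(y, t). (y \<otimes> inv (foldr (\<otimes>) t \<one>)) # t) (foldr (\<otimes>) hs \<one>, tl hs) = hs"
      by (auto simp: length_Suc_conv m_assoc foldr_mult_closed)
    show "\<forall>p\<in>S \<times> ?T. (\<lambda>hs. (foldr (\<otimes>) hs \<one>, tl hs)) ((\<lambda>(y, t). (y \<otimes> inv (foldr (\<otimes>) t \<one>)) # t) p) = p"
      using assms(2) by (auto simp: m_assoc foldr_mult_closed subset_iff)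
    show "(\<lambda>hs. (foldr (\<otimes>) hs \<one>, tl hs)) ` ?L \<subseteq> S \<times> ?T"
      by (auto simp: length_Suc_conv)
    show "(\<lambda>(y, t). (y \<otimes> inv (foldr (\<otimes>) t \<one>)) # t) ` (S \<times> ?T) \<subseteq> ?L"
      using assms(2) by (auto simp: m_assoc foldr_mult_closed subset_iff)
  qed
  then show ?thesis
    using assms(1) by (simp add: bij_betw_same_card card_cartesian_product card_lists_length_eq)
qed

text \<open>Counts cycles with a marked starting point \<open>x\<close>. Reading vertices and labels
  once around from \<open>x\<close> gives an arrangement of \<open>R\<close> and an independent list
  of labels. Since \<open>m\<close> steps make \<open>m div p\<close> turns, the product of this
  list must have trivial power \<open>m div p\<close>.\<close>

lemma card_mult_card_cycles:
  assumes "finite (carrier G)" "finite R" "card R dvd m" "0 < m"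
  shows "card R * card (cycles G m R) =
    fact (card R) * (iota G (m div card R) * card (carrier G) ^ (card R - 1))"
proof -
  define p where "p = card R"
  define S where "S = {y \<in> carrier G. y [^] (m div p) = \<one>}"
  define L where "L = {hs. set hs \<subseteq> carrier G \<and> length hs = p \<and> foldr (\<otimes>) hs \<one> \<in> S}"
  let ?xs = "\<lambda>(x, g). map (\<lambda>i. (tgt g ^^ i) x) [0..<p]"
  let ?hs = "\<lambda>(x, g). map (\<lambda>i. fst (g ((tgt g ^^ i) x))) [0..<p]"
  \<comment> \<open>\<open>?g\<close> rebuilds the cycle from both lists: \<open>?idx\<close> finds
    the position of a vertex, and reducing the next index modulo \<open>p\<close> sends the last
    vertex back to the first.\<close>
  let ?idx = "\<lambda>xs. the_inv_into {..<p} (nth xs)"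
  let ?g = "\<lambda>(xs, hs). \<lambda>y\<in>R. (hs ! ?idx xs y, xs ! (Suc (?idx xs y) mod p))"
  have "0 < p" using assms(3,4) unfolding p_def by (auto intro: Nat.gr0I)
  have m: "m = p * (m div p)" using assms(3) by (simp add: p_def)
  have idx: "?idx xs (xs ! i) = i" if "xs \<in> permutations_of_set R" "i < p" for xs i
  proof (rule the_inv_into_f_f)
    show "inj_on (nth xs) {..<p}"
      using that by (auto simp: permutations_of_set_def inj_on_def nth_eq_iff_index_eq distinct_card p_def)
  qed (use that in auto)
  have ex: "\<exists>i<p. y = xs ! i" if "xs \<in> permutations_of_set R" "y \<in> R" for xs y
    using that by (auto simp: permutations_of_set_def in_set_conv_nth distinct_card p_def)
  have len: "length xs = p" "set xs = R" "i < p \<Longrightarrow> xs ! i \<in> R" if "xs \<in> permutations_of_set R" for xs i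
    using that by (auto simp: permutations_of_set_def distinct_card p_def)
  have gv: "?g (xs, hs) (xs ! i) = (hs ! i, xs ! (Suc i mod p))"
    if "xs \<in> permutations_of_set R" "i < p" for xs hs i
    using idx [OF that] len(3) [OF that] by simp
  have pw: "(tgt (?g (xs, hs)) ^^ i) (xs ! 0) = xs ! (i mod p)"
    if "xs \<in> permutations_of_set R" for xs hs i
  proof (induction i)
    case (Suc i)
    have "(tgt (?g (xs, hs)) ^^ Suc i) (xs ! 0) = tgt (?g (xs, hs)) (xs ! (i mod p))"
      unfolding funpow.simps comp_def Suc ..
    also have "\<dots> = xs ! (Suc (i mod p) mod p)"
      unfolding tgt_def using gv [OF that, of "i mod p" hs] \<open>0 < p\<close> by simp
    finally show ?case by (simp only: mod_Suc_eq)
  qed (simp add: \<open>0 < p\<close>)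
  have "bij_betw (\<lambda>c. (?xs c, ?hs c)) (R \<times> cycles G m R) (permutations_of_set R \<times> L)"
  proof (rule bij_betw_byWitness [where f' = "\<lambda>(xs, hs). (xs ! 0, ?g (xs, hs))"])
    have *: "?xs (x, g) \<in> permutations_of_set R" "?hs (x, g) \<in> L" "?g (?xs (x, g), ?hs (x, g)) = g"
      if x: "x \<in> R" and g: "g \<in> cycles G m R" for x g
    proof -
      note b = cycle_orbit [OF g assms(2) x assms(4), folded p_def]
      note c = cyclesD [OF g]
      have inR: "(tgt g ^^ i) x \<in> R" for i using x by (intro tgt_funpow_closed c)
      show perm: "?xs (x, g) \<in> permutations_of_set R"
        using b(1) by (auto simp: permutations_of_set_def distinct_map bij_betw_def lessThan_atLeast0)
      have "path_prod G g p x [^] (m div p) = \<one>"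
        using path_prod_period [OF c(2) x b(2), of "m div p"] m c(6) [OF x] by simp
      moreover have "path_prod G g p x \<in> carrier G" using path_prod_closed [OF c(2) x] .
      ultimately show "?hs (x, g) \<in> L"
        using c(2) inR by (auto simp: L_def S_def path_prod_eq_foldr [symmetric] mem_Times_iff)
      show "?g (?xs (x, g), ?hs (x, g)) = g"
      proof (rule ext)
        fix y
        show "?g (?xs (x, g), ?hs (x, g)) y = g y"
        proof (cases "y \<in> R")
          case True
          then obtain i where i: "i < p" "y = ?xs (x, g) ! i" using ex [OF perm] by blast
          have "?g (?xs (x, g), ?hs (x, g)) y = (?hs (x, g) ! i, ?xs (x, g) ! (Suc i mod p))"
            unfolding i(2) by (rule gv [OF perm i(1)])
          also have "\<dots> = (fst (g y), (tgt g ^^ (Suc i mod p)) x)"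
            using i \<open>0 < p\<close> by simp
          also have "(tgt g ^^ (Suc i mod p)) x = tgt g y"
            using funpow_mod_eq [OF b(2), of "Suc i"] i by simp
          also have "(fst (g y), tgt g y) = g y" by (simp add: tgt_def)
          finally show ?thesis .
        next
          case False
          then show ?thesis using c(1) by (auto simp: extensional_def)
        qed
      qed
    qed
    show "\<forall>c\<in>R \<times> cycles G m R. (\<lambda>(xs, hs). (xs ! 0, ?g (xs, hs))) (?xs c, ?hs c) = c"
      using *(3) \<open>0 < p\<close> by auto
    show "(\<lambda>c. (?xs c, ?hs c)) ` (R \<times> cycles G m R) \<subseteq> permutations_of_set R \<times> L"
      using *(1,2) by auto
    have **: "xs ! 0 \<in> R" "?g (xs, hs) \<in> cycles G m R" "?xs (xs ! 0, ?g (xs, hs)) = xs"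
        "?hs (xs ! 0, ?g (xs, hs)) = hs"
      if xs: "xs \<in> permutations_of_set R" and hs: "hs \<in> L" for xs hs
    proof -
      define g where "g = ?g (xs, hs)"
      note pw' = pw [OF xs, of _ hs, folded g_def] and gv' = gv [OF xs, of _ hs, folded g_def]
      show x: "xs ! 0 \<in> R" using len [OF xs] \<open>0 < p\<close> by simp
      show 1: "?xs (xs ! 0, ?g (xs, hs)) = xs"
        unfolding g_def [symmetric] using len [OF xs] by (auto simp: list_eq_iff_nth_eq pw')
      have hl: "length hs = p" "set hs \<subseteq> carrier G" using hs by (auto simp: L_def)
      show 2: "?hs (xs ! 0, ?g (xs, hs)) = hs"
        unfolding g_def [symmetric] using hl by (auto simp: list_eq_iff_nth_eq pw' gv')
      have gR: "g y \<in> carrier G \<times> R" if "y \<in> R" for y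
      proof -
        obtain i where i: "i < p" "y = xs ! i" using ex [OF xs \<open>y \<in> R\<close>] by blast
        have "hs ! i \<in> carrier G" using hl i by auto
        then show ?thesis using gv' [OF i(1)] i len(3) [OF xs] \<open>0 < p\<close> by auto
      qed
      have per0: "(tgt g ^^ p) (xs ! 0) = xs ! 0" using pw' [of p] by simp
      have per: "(tgt g ^^ m) (xs ! 0) = xs ! 0" using tgt_funpow_period [OF per0] m by metis
      have "path_prod G g p (xs ! 0) \<in> S"
        using 2 [folded g_def] hs by (simp add: path_prod_eq_foldr L_def)
      then have pp: "path_prod G g m (xs ! 0) = \<one>"
        using path_prod_period [OF gR x per0, of "m div p"] m by (simp add: S_def)
      have from0: "\<exists>i. y = (tgt g ^^ i) (xs ! 0) \<and> i < p" if "y \<in> R" for y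
        using ex [OF xs that] pw' by (metis mod_less)
      have "\<exists>i. (tgt g ^^ i) y = z" if "y \<in> R" "z \<in> R" for y z
      proof -
        obtain i j where ij: "y = (tgt g ^^ i) (xs ! 0)" "i < p" "z = (tgt g ^^ j) (xs ! 0)"
          using from0 \<open>y \<in> R\<close> \<open>z \<in> R\<close> by blast
        \<comment> \<open>From position \<open>i\<close>, \<open>p - i\<close> steps complete the
          turn to the starting point, and \<open>j\<close> more lead to \<open>z\<close>.\<close>
        have "(tgt g ^^ (j + (p - i))) y = (tgt g ^^ (j + p)) (xs ! 0)"
          unfolding ij(1) using \<open>i < p\<close> by (simp add: funpow_add [THEN fun_cong, unfolded comp_def, symmetric])
        also have "\<dots> = z" using per0 ij(3) by (simp add: funpow_add)
        finally show ?thesis by blast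
      qed
      moreover have "(tgt g ^^ m) y = y \<and> path_prod G g m y = \<one>" if "y \<in> R" for y
      proof -
        obtain i where i: "y = (tgt g ^^ i) (xs ! 0)" using from0 \<open>y \<in> R\<close> by blast
        have "(tgt g ^^ m) y = (tgt g ^^ i) ((tgt g ^^ m) (xs ! 0))"
          unfolding i by (simp add: funpow_add [THEN fun_cong, unfolded comp_def, symmetric] add.commute)
        then show ?thesis using path_prod_shift_one [OF gR x per pp] i per by simp
      qed
      moreover have "g \<in> extensional R" by (simp add: g_def)
      ultimately have "g \<in> cycles G m R"
        using gR x by (auto simp: cycles_def PiE_iff)
      then show "?g (xs, hs) \<in> cycles G m R" by (simp only: g_def)
    qed
    show "\<forall>q\<in>permutations_of_set R \<times> L.
        (\<lambda>c. (?xs c, ?hs c)) ((\<lambda>(xs, hs). (xs ! 0, ?g (xs, hs))) q) = q"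
      using **(3,4) by auto
    show "(\<lambda>(xs, hs). (xs ! 0, ?g (xs, hs))) ` (permutations_of_set R \<times> L) \<subseteq> R \<times> cycles G m R"
      using **(1,2) by auto
  qed
  from bij_betw_same_card [OF this] have "card R * card (cycles G m R) = fact p * card L"
    using assms(2) by (simp add: card_cartesian_product p_def)
  also have "card L = card S * card (carrier G) ^ (p - 1)"
    using card_lists_foldr_mult [OF assms(1), of S "p - 1"] \<open>0 < p\<close> by (simp add: L_def S_def)
  also have "card S = iota G (m div p)" by (simp add: S_def iota_def)
  finally show ?thesis by (simp add: p_def)
qed

text \<open>Written with \<open>fact r / r\<close> and a full power of \<open>h\<close> over
  \<open>h\<close>, so that the power can later be absorbed into \<open>scaled_Delta\<close> and the
  outer factor \<open>1 / h\<close> remains. For empty \<open>R\<close> the second case applies, as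
  0 does not divide a positive \<open>m\<close>.\<close>

lemma card_cycles:
  assumes "finite (carrier G)" "finite R" "0 < m"
  shows "(of_nat (card (cycles G m R)) :: rat) =
    (if card R dvd m
     then fact (card R) / of_nat (card R) * of_nat (iota G (m div card R)) *
       of_nat (card (carrier G)) ^ card R / of_nat (card (carrier G))
     else 0)"
proof (cases "card R dvd m")
  case True
  let ?c = "of_nat (card (carrier G)) :: rat" and ?r = "of_nat (card R) :: rat"
  have r: "0 < card R" using True assms(3) by (auto intro: Nat.gr0I)
  have c: "0 < card (carrier G)" using assms(1) one_closed card_gt_0_iff by blast
  have "?r * of_nat (card (cycles G m R)) =
      fact (card R) * (of_nat (iota G (m div card R)) * ?c ^ (card R - 1))"
    using arg_cong [OF card_mult_card_cycles [OF assms(1,2) True assms(3)], of "of_nat :: nat \<Rightarrow> rat"] by simp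
  moreover have "?c ^ card R = ?c * ?c ^ (card R - 1)" using r by (simp flip: power_Suc)
  ultimately show ?thesis using True r c by (simp add: field_simps)
next
  case False
  have "cycles G m R = {}"
  proof (rule equals0I)
    fix g assume g: "g \<in> cycles G m R"
    then obtain x where "x \<in> R" by (auto simp: cycles_def)
    with cycle_orbit(3) [OF g assms(2) _ assms(3)] False show False by blast
  qed
  then show ?thesis using False by simp
qed

end

section \<open>Components and solutions\<close>

definition comp_of :: "'v set \<Rightarrow> ('v \<Rightarrow> 'a \<times> 'v) \<Rightarrow> 'v \<Rightarrow> 'v set" where
  "comp_of A g x = {y\<in>A. \<exists>k l. (tgt g ^^ k) x = (tgt g ^^ l) y}"

definition comps :: "'v set \<Rightarrow> ('v \<Rightarrow> 'a \<times> 'v) \<Rightarrow> 'v set set" where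
  "comps A g = comp_of A g ` A"

text \<open>Both coordinates of the equation, read off at the single point \<open>x\<close>; this
  makes it a condition that can be checked on each piece of the ground set.\<close>

definition solves_at ::
    "('a, 'b) monoid_scheme \<Rightarrow> nat \<Rightarrow> nat \<Rightarrow> ('v \<Rightarrow> 'a \<times> 'v) \<Rightarrow> 'v \<Rightarrow> bool" where
  "solves_at H a b g x \<longleftrightarrow>
    (tgt g ^^ a) x = (tgt g ^^ b) x \<and> path_prod H g a x = path_prod H g b x"

definition sols :: "('a, 'b) monoid_scheme \<Rightarrow> nat \<Rightarrow> nat \<Rightarrow> 'v set \<Rightarrow> ('v \<Rightarrow> 'a \<times> 'v) set" where
  "sols H a b A = {g \<in> A \<rightarrow>\<^sub>E carrier H \<times> A. \<forall>x\<in>A. solves_at H a b g x}"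

text \<open>The empty set is excluded, since its set of components is empty.\<close>

definition conn_sols :: "('a, 'b) monoid_scheme \<Rightarrow> nat \<Rightarrow> nat \<Rightarrow> 'v set \<Rightarrow> ('v \<Rightarrow> 'a \<times> 'v) set" where
  "conn_sols H a b A = {g \<in> sols H a b A. comps A g = {A}}"

text \<open>The number of components is fixed to \<open>k\<close>; the set \<open>M\<close> enters
  only when these counts are summed over \<open>k\<close>.\<close>

definition adm_sols ::
    "('a, 'b) monoid_scheme \<Rightarrow> nat \<Rightarrow> nat \<Rightarrow> nat set \<Rightarrow> nat \<Rightarrow> 'v set \<Rightarrow> ('v \<Rightarrow> 'a \<times> 'v) set" where
  "adm_sols H a b \<Lambda> k A =
    {g \<in> sols H a b A. (\<forall>C\<in>comps A g. card C \<in> \<Lambda>) \<and> card (comps A g) = k}"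

lemma finite_sols:
  assumes "finite A" "finite (carrier H)"
  shows "finite (sols H a b A)"
  unfolding sols_def using assms
  by (intro finite_subset [OF _ finite_PiE [of A "\<lambda>_. carrier H \<times> A"]]) auto

lemma mem_comp_of_self: "x \<in> A \<Longrightarrow> x \<in> comp_of A g x"
  by (auto simp: comp_of_def)

text \<open>Merging of orbits is transitive: if \<open>k\<close> steps from \<open>u\<close> meet
  \<open>l\<close> steps from \<open>v\<close>, and \<open>k'\<close> steps from \<open>u\<close>
  meet \<open>l'\<close> steps from \<open>w\<close>, then \<open>k' + l\<close> steps from
  \<open>v\<close> meet \<open>k + l'\<close> steps from \<open>w\<close>.\<close>

lemma comp_of_eq:
  assumes "y \<in> comp_of A g x"
  shows "comp_of A g y = comp_of A g x"
proof -
  obtain k l where kl: "(tgt g ^^ k) x = (tgt g ^^ l) y" using assms by (auto simp: comp_of_def)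
  have *: "(tgt g ^^ (i + j)) u = (tgt g ^^ i) ((tgt g ^^ j) u)" for i j u
    by (simp add: funpow_add)
  have **: "\<exists>i j. (tgt g ^^ i) v = (tgt g ^^ j) w"
    if "(tgt g ^^ k) u = (tgt g ^^ l) v" "(tgt g ^^ k') u = (tgt g ^^ l') w" for u v w k l k' l'
  proof -
    have "(tgt g ^^ (k' + l)) v = (tgt g ^^ (k + l')) w"
      using that by (metis * add.commute)
    then show ?thesis by blast
  qed
  show ?thesis
    unfolding comp_of_def using ** [OF kl] ** [OF kl [symmetric]] by blast
qed

lemma tgt_mem_comp_of:
  assumes "y \<in> A" "tgt g y \<in> A"
  shows "tgt g y \<in> comp_of A g x \<longleftrightarrow> y \<in> comp_of A g x"
proof -
  have "(\<exists>k l. (tgt g ^^ k) x = (tgt g ^^ l) (tgt g y)) \<longleftrightarrow> (\<exists>k l. (tgt g ^^ k) x = (tgt g ^^ l) y)"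
    (is "?l \<longleftrightarrow> ?r")
  proof
    assume ?l
    then obtain k l where "(tgt g ^^ k) x = (tgt g ^^ Suc l) y" by (auto simp: funpow_swap1)
    then show ?r by blast
  next
    assume ?r
    then obtain k l where "(tgt g ^^ k) x = (tgt g ^^ l) y" by blast
    then have "(tgt g ^^ Suc k) x = (tgt g ^^ l) (tgt g y)" by (simp add: funpow_swap1)
    then show ?l by blast
  qed
  then show ?thesis using assms by (simp add: comp_of_def)
qed

lemma comps_eq_singleton_iff:
  "comps A g = {A} \<longleftrightarrow> A \<noteq> {} \<and> (\<forall>x\<in>A. \<forall>y\<in>A. \<exists>k l. (tgt g ^^ k) x = (tgt g ^^ l) y)"
proof -
  have "comp_of A g x = A \<longleftrightarrow> (\<forall>y\<in>A. \<exists>k l. (tgt g ^^ k) x = (tgt g ^^ l) y)" for x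
    unfolding comp_of_def by blast
  moreover have "f ` S = {c} \<longleftrightarrow> S \<noteq> {} \<and> (\<forall>x\<in>S. f x = c)" for f :: "'a \<Rightarrow> 'a set" and S c
    by auto
  ultimately show ?thesis unfolding comps_def by presburger
qed

text \<open>\<open>B\<close> is closed under \<open>tgt g\<close> and under preimages in
  \<open>A\<close>, so no orbit from outside \<open>B\<close> merges with one from inside.\<close>

lemma comp_of_restrict:
  assumes "B \<subseteq> A" "\<And>x. x \<in> A \<Longrightarrow> tgt g x \<in> A" "\<And>x. x \<in> A \<Longrightarrow> tgt g x \<in> B \<longleftrightarrow> x \<in> B" "x \<in> B"
  shows "comp_of B (restrict g B) x = comp_of A g x"
proof -
  have cl: "tgt g x \<in> B" if "x \<in> B" for x using that assms by auto
  have e: "(tgt (restrict g B) ^^ k) y = (tgt g ^^ k) y" if "y \<in> B" for y k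
    using tgt_funpow_cong [of B g "restrict g B" y k] cl that by auto
  have pull: "y \<in> B" if "y \<in> A" "(tgt g ^^ l) y \<in> B" for y l
    using that
  proof (induction l arbitrary: y)
    case (Suc l)
    then have "tgt g y \<in> B" using assms(2) by (simp add: funpow_swap1)
    then show ?case using Suc.prems assms(3) by simp
  qed simp
  have "y \<in> B" if "y \<in> A" "(tgt g ^^ k) x = (tgt g ^^ l) y" for y k l
    using pull [OF that(1), of l] tgt_funpow_closed [of B g x k] cl assms(4) that(2) by metis
  then have "y \<in> comp_of B (restrict g B) x \<longleftrightarrow> y \<in> comp_of A g x" for y
    using assms(1,4) by (cases "y \<in> B") (auto simp: comp_of_def e)
  then show ?thesis by blast
qed

lemma comps_split:
  assumes "B \<subseteq> A" "\<And>x. x \<in> A \<Longrightarrow> tgt g x \<in> A" "\<And>x. x \<in> A \<Longrightarrow> tgt g x \<in> B \<longleftrightarrow> x \<in> B"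
  shows "comps A g = comps B (restrict g B) \<union> comps (A - B) (restrict g (A - B))"
proof -
  have "comp_of (A - B) (restrict g (A - B)) x = comp_of A g x" if "x \<in> A - B" for x
    by (rule comp_of_restrict) (use assms that in auto)
  moreover have "comp_of B (restrict g B) x = comp_of A g x" if "x \<in> B" for x
    by (rule comp_of_restrict [OF assms that])
  moreover have "A = B \<union> (A - B)" using assms(1) by auto
  ultimately show ?thesis
    unfolding comps_def by (metis (no_types, lifting) image_Un image_cong)
qed

section \<open>Splitting off one component\<close>

text \<open>Orbits that start in a closed set stay there, so restricting changes neither iterates
  nor path products.\<close>

lemma restrict_sols_iff:
  "restrict g B \<in> sols H a b B \<longleftrightarrow> (\<forall>x\<in>B. g x \<in> carrier H \<times> B \<and> solves_at H a b g x)"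
proof (cases "\<forall>x\<in>B. g x \<in> carrier H \<times> B")
  case True
  then have cl: "tgt g x \<in> B" if "x \<in> B" for x using that by (auto simp: tgt_def mem_Times_iff)
  have "solves_at H a b (restrict g B) x \<longleftrightarrow> solves_at H a b g x" if "x \<in> B" for x
    using tgt_funpow_cong [of B g "restrict g B" x] path_prod_cong [of B g "restrict g B" x H] cl that
    by (simp add: solves_at_def)
  then show ?thesis using True by (auto simp: sols_def)
next
  case False
  then show ?thesis by (auto simp: sols_def)
qed

text \<open>No edge joins a component \<open>B\<close> to its complement, so \<open>g\<close> falls
  apart into two unrelated maps. The equation is checked pointwise, and the components of
  \<open>g\<close> are \<open>B\<close> and those of the rest.\<close>

lemma adm_sols_split:
  assumes "finite A" "B \<subseteq> A" "card B \<in> \<Lambda>" "g \<in> extensional A"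
  shows "g \<in> {g \<in> adm_sols H a b \<Lambda> (Suc k) A. B \<in> comps A g} \<longleftrightarrow>
    restrict g B \<in> conn_sols H a b B \<and> restrict g (A - B) \<in> adm_sols H a b \<Lambda> k (A - B)"
    (is "?l \<longleftrightarrow> ?r")
proof -
  let ?u = "restrict g B" and ?v = "restrict g (A - B)"
  \<comment> \<open>Each direction supplies these closure and connectedness conditions, under which
    the equivalence is proved once.\<close>
  have *: "?l \<longleftrightarrow> ?r" if t: "\<And>x. x \<in> A \<Longrightarrow> tgt g x \<in> A" "\<And>x. x \<in> A \<Longrightarrow> tgt g x \<in> B \<longleftrightarrow> x \<in> B"
    and B: "comps B ?u = {B}"
  proof -
    have split: "comps A g = insert B (comps (A - B) ?v)"
      using comps_split [OF assms(2) t] B by simp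
    \<comment> \<open>A nonempty \<open>B\<close> is not contained in \<open>A - B\<close>, so it is
      a new component and the number rises by exactly one.\<close>
    have "B \<noteq> {}" using B by (auto simp: comps_def)
    then have notin: "B \<notin> comps (A - B) ?v"
      by (auto simp: comps_def comp_of_def)
    have fin: "finite (comps (A - B) ?v)" using assms(1) by (simp add: comps_def)
    have "g \<in> sols H a b A \<longleftrightarrow> ?u \<in> sols H a b B \<and> ?v \<in> sols H a b (A - B)"
    proof -
      have "g \<in> sols H a b A \<longleftrightarrow> (\<forall>x\<in>A. g x \<in> carrier H \<times> A \<and> solves_at H a b g x)"
        using restrict_sols_iff [of g A H a b] assms(4) by (simp add: extensional_restrict)
      also have "\<dots> \<longleftrightarrow> (\<forall>x\<in>B. g x \<in> carrier H \<times> B \<and> solves_at H a b g x) \<and>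
          (\<forall>x\<in>A - B. g x \<in> carrier H \<times> (A - B) \<and> solves_at H a b g x)"
        using t assms(2) by (fastforce simp: tgt_def mem_Times_iff)
      finally show ?thesis unfolding restrict_sols_iff .
    qed
    then show ?thesis
      using split notin fin B assms(3) by (auto simp: adm_sols_def conn_sols_def)
  qed
  show ?thesis
  proof
    assume l: ?l
    then have t: "\<And>x. x \<in> A \<Longrightarrow> tgt g x \<in> A"
      by (auto simp: adm_sols_def sols_def PiE_iff tgt_def mem_Times_iff)
    obtain x where x: "x \<in> A" "B = comp_of A g x" using l by (auto simp: comps_def)
    have t': "\<And>y. y \<in> A \<Longrightarrow> tgt g y \<in> B \<longleftrightarrow> y \<in> B"
      using tgt_mem_comp_of t unfolding x(2) by metis
    have "comp_of B ?u y = B" if "y \<in> B" for y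
      using comp_of_restrict [OF assms(2) t t' that] comp_of_eq [of y A g x] that x(2) by simp
    moreover have "B \<noteq> {}" using x mem_comp_of_self by fastforce
    ultimately have "comps B ?u = {B}" by (auto simp: comps_def)
    then show ?r using * t t' l by blast
  next
    assume r: ?r
    then have u: "\<And>x. x \<in> B \<Longrightarrow> g x \<in> carrier H \<times> B" and B: "comps B ?u = {B}"
      and v: "\<And>x. x \<in> A - B \<Longrightarrow> g x \<in> carrier H \<times> (A - B)"
      unfolding conn_sols_def adm_sols_def mem_Collect_eq restrict_sols_iff by auto
    have "tgt g x \<in> A \<and> (tgt g x \<in> B \<longleftrightarrow> x \<in> B)" if "x \<in> A" for x
      using u [of x] v [of x] that assms(2) by (cases "x \<in> B") (auto simp: tgt_def mem_Times_iff)
    then show ?l using * B r by blast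
  qed
qed

text \<open>Double counting of the pairs of a solution and one of its \<open>Suc k\<close>
  components \<open>B\<close>. The size restriction on \<open>B\<close> moves into the factor for
  connected solutions.\<close>

lemma card_adm_sols_Suc:
  assumes "finite A" "finite (carrier H)"
  shows "Suc k * card (adm_sols H a b \<Lambda> (Suc k) A) =
    (\<Sum>B\<in>Pow A. (if card B \<in> \<Lambda> then card (conn_sols H a b B) else 0) * card (adm_sols H a b \<Lambda> k (A - B)))"
proof -
  let ?S = "adm_sols H a b \<Lambda> (Suc k) A"
  have fin: "finite ?S" using finite_sols [OF assms] by (simp add: adm_sols_def)
  have "Suc k * card ?S = (\<Sum>g\<in>?S. card {B \<in> Pow A. B \<in> comps A g})"
  proof -
    have "card {B \<in> Pow A. B \<in> comps A g} = Suc k" if "g \<in> ?S" for g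
    proof -
      have "{B \<in> Pow A. B \<in> comps A g} = comps A g" by (auto simp: comps_def comp_of_def)
      then show ?thesis using that by (simp add: adm_sols_def)
    qed
    then show ?thesis by simp
  qed
  also have "\<dots> = (\<Sum>B\<in>Pow A. card {g \<in> ?S. B \<in> comps A g})"
    using fin assms(1) by (intro sum_multicount_gen) auto
  also have "\<dots> = (\<Sum>B\<in>Pow A. (if card B \<in> \<Lambda> then card (conn_sols H a b B) else 0) *
      card (adm_sols H a b \<Lambda> k (A - B)))"
  proof (rule sum.cong [OF refl])
    fix B assume B: "B \<in> Pow A"
    show "card {g \<in> ?S. B \<in> comps A g} =
      (if card B \<in> \<Lambda> then card (conn_sols H a b B) else 0) * card (adm_sols H a b \<Lambda> k (A - B))"
    proof (cases "card B \<in> \<Lambda>")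
      case True
      then have "card {g \<in> ?S. B \<in> comps A g} =
          card (conn_sols H a b B) * card (adm_sols H a b \<Lambda> k (A - B))"
        using B assms(1) by (intro card_extensional_split [OF _ _ _ _ adm_sols_split])
          (auto simp: adm_sols_def conn_sols_def sols_def PiE_iff)
      then show ?thesis using True by simp
    next
      case False
      then have "{g \<in> ?S. B \<in> comps A g} = {}" by (auto simp: adm_sols_def)
      then have "card {g \<in> ?S. B \<in> comps A g} = 0" by (simp only: card.empty)
      then show ?thesis using False by simp
    qed
  qed
  finally show ?thesis .
qed

section \<open>Connected solutions as one cycle with a forest attached\<close>

text \<open>In a connected solution the points fixed by \<open>b - a\<close> steps form the only
  cycle. Every point arrives there within \<open>a\<close> steps, so the other points form a forest
  of height at most \<open>a\<close> rooted on the cycle.\<close>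

lemma (in group) conn_sols_split:
  assumes "R \<subseteq> A" "g \<in> extensional A" "a < b"
  shows "g \<in> {g \<in> conn_sols G a b A. {x\<in>A. (tgt g ^^ (b - a)) x = x} = R} \<longleftrightarrow>
    restrict g R \<in> cycles G (b - a) R \<and> restrict g (A - R) \<in> forests G a (A - R) R"
    (is "?l \<longleftrightarrow> ?r")
proof -
  let ?u = "restrict g R" and ?v = "restrict g (A - R)" and ?t = "tgt g"
  define m where "m = b - a"
  have m: "0 < m" "b = a + m" using assms(3) by (auto simp: m_def)
  have add: "(?t ^^ (i + j)) x = (?t ^^ i) ((?t ^^ j) x)" for i j x by (simp add: funpow_add)
  have conn: "g \<in> conn_sols G a b A \<longleftrightarrow> (\<forall>x\<in>A. g x \<in> carrier G \<times> A \<and> solves_at G a b g x) \<and>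
      A \<noteq> {} \<and> (\<forall>x\<in>A. \<forall>y\<in>A. \<exists>k l. (?t ^^ k) x = (?t ^^ l) y)"
    using restrict_sols_iff [of g A G a b] assms(2)
    by (simp add: extensional_restrict conn_sols_def comps_eq_singleton_iff)
  \<comment> \<open>Split the path of \<open>a + m\<close> steps after \<open>a\<close> steps and
    cancel the common first product: the equation at \<open>x\<close> becomes a condition at the
    point reached after \<open>a\<close> steps.\<close>
  have solves: "solves_at G a b g x \<longleftrightarrow>
      (?t ^^ m) ((?t ^^ a) x) = (?t ^^ a) x \<and> path_prod G g m ((?t ^^ a) x) = \<one>"
    if gA: "\<And>x. x \<in> A \<Longrightarrow> g x \<in> carrier G \<times> A" and x: "x \<in> A" for x
  proof -
    have t: "\<And>x. x \<in> A \<Longrightarrow> ?t x \<in> A" using gA by (auto simp: tgt_def mem_Times_iff)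
    have "(?t ^^ b) x = (?t ^^ m) ((?t ^^ a) x)" unfolding m(2) by (metis add add.commute)
    moreover have "path_prod G g b x = path_prod G g a x \<otimes> path_prod G g m ((?t ^^ a) x)"
      unfolding m(2) by (rule path_prod_add [OF gA x])
    moreover have "path_prod G g a x \<in> carrier G"
      using path_prod_closed [OF gA x] .
    moreover have "path_prod G g m ((?t ^^ a) x) \<in> carrier G"
      using path_prod_closed [OF gA tgt_funpow_closed [OF t x]] .
    ultimately show ?thesis
      unfolding solves_at_def by (metis l_cancel_one' r_cancel_one')
  qed
  \<comment> \<open>On the cycle one goes back \<open>a\<close> steps by going forward
    \<open>m * a - a\<close> steps.\<close>
  have le_am: "a \<le> m * a" using m(1) by simp
  have cong: "(tgt ?u ^^ k) x = (?t ^^ k) x" "path_prod G ?u k x = path_prod G g k x"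
    if "\<And>x. x \<in> R \<Longrightarrow> ?t x \<in> R" "x \<in> R" for x k
    using tgt_funpow_cong [of R g ?u x k] path_prod_cong [of R g ?u x G k] that by auto
  show ?thesis
  proof
    assume l: ?l
    then have gA: "\<And>x. x \<in> A \<Longrightarrow> g x \<in> carrier G \<times> A" and sol: "\<And>x. x \<in> A \<Longrightarrow> solves_at G a b g x"
      and ne: "A \<noteq> {}" and con: "\<And>x y. \<lbrakk>x \<in> A; y \<in> A\<rbrakk> \<Longrightarrow> \<exists>k l. (?t ^^ k) x = (?t ^^ l) y"
      and R: "{x\<in>A. (?t ^^ m) x = x} = R"
      using conn by (auto simp: m_def)
    have t: "\<And>x. x \<in> A \<Longrightarrow> ?t x \<in> A" using gA by (auto simp: tgt_def mem_Times_iff)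
    have tR: "?t x \<in> R" if "x \<in> R" for x
    proof -
      have "(?t ^^ m) (?t x) = ?t ((?t ^^ m) x)" by (simp add: funpow_swap1)
      then show ?thesis using that R t by auto
    qed
    have gR: "g x \<in> carrier G \<times> R" if "x \<in> R" for x
      using tR [OF that] gA [of x] that assms(1) by (auto simp: tgt_def mem_Times_iff)
    have per: "(?t ^^ (m * k)) x = x" if "x \<in> R" for x k
      using R that by (intro tgt_funpow_period) auto
    have aR: "(?t ^^ a) x \<in> R" if "x \<in> A" for x
      using sol [OF that] solves [OF gA that] tgt_funpow_closed [OF t that] R by auto
    have cyc: "\<exists>i. (?t ^^ i) x = y" if "x \<in> R" "y \<in> R" for x y
    proof -
      have "x \<in> A" "y \<in> A" using that assms(1) by auto
      then obtain k l where kl: "(?t ^^ k) x = (?t ^^ l) y" using con by blast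
      \<comment> \<open>The \<open>l\<close> steps made from \<open>y\<close> are completed to
        \<open>m * l\<close> steps, a multiple of the period, which return to
        \<open>y\<close>.\<close>
      have "(?t ^^ (m * l - l + k)) x = (?t ^^ (m * l - l + l)) y" by (simp only: add kl)
      also have "\<dots> = y" using per [OF that(2)] m(1) by simp
      finally show ?thesis by blast
    qed
    have one: "path_prod G g m x = \<one>" if "x \<in> R" for x
    proof -
      have xA: "x \<in> A" using that assms(1) by auto
      \<comment> \<open>The point \<open>a\<close> steps before \<open>x\<close> on the cycle: the
        equation at \<open>y\<close> is the product condition at \<open>x\<close>.\<close>
      define y where "y = (?t ^^ (m * a - a)) x"
      have y: "y \<in> A" unfolding y_def using tgt_funpow_closed [OF t xA] .
      have "(?t ^^ a) y = x"
        unfolding y_def using add [of a "m * a - a" x] per [OF that, of a] le_am by simp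
      then show ?thesis using sol [OF y] solves [OF gA y] by simp
    qed
    have "?u \<in> cycles G m R"
      unfolding cycles_def using gR cyc one per [of _ 1] ne aR
      by (auto simp: cong [OF tR])
    moreover have "?v \<in> forests G a (A - R) R"
    proof -
      have vA: "?t x \<in> (A - R) \<union> R" if "x \<in> A - R" for x using t that by auto
      have "reaches ?v R a x" if "x \<in> A - R" for x
        using reaches_cong [of "A - R" g R ?v x a] vA that aR [of x]
        by (auto simp: reaches_iff [of g])
      then show ?thesis using gA by (auto simp: forests_def mem_Times_iff)
    qed
    ultimately show ?r by (simp add: m_def)
  next
    assume r: ?r
    then have uc: "?u \<in> cycles G m R" and vf: "?v \<in> forests G a (A - R) R" by (auto simp: m_def)
    have gR: "\<And>x. x \<in> R \<Longrightarrow> g x \<in> carrier G \<times> R"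
      using cyclesD(2) [OF uc] by simp
    have vA: "\<And>x. x \<in> A - R \<Longrightarrow> g x \<in> carrier G \<times> A"
      using vf assms(1) by (fastforce simp: forests_def PiE_iff mem_Times_iff)
    have gA: "g x \<in> carrier G \<times> A" if "x \<in> A" for x
      using gR [of x] vA [of x] that assms(1) by (auto simp: mem_Times_iff)
    have t: "\<And>x. x \<in> A \<Longrightarrow> ?t x \<in> A" using gA by (auto simp: tgt_def mem_Times_iff)
    have tR: "\<And>x. x \<in> R \<Longrightarrow> ?t x \<in> R" using gR by (auto simp: tgt_def mem_Times_iff)
    have cyc: "\<And>x y. \<lbrakk>x \<in> R; y \<in> R\<rbrakk> \<Longrightarrow> \<exists>i. (?t ^^ i) x = y"
      and per: "\<And>x. x \<in> R \<Longrightarrow> (?t ^^ m) x = x"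
      and one: "\<And>x. x \<in> R \<Longrightarrow> path_prod G g m x = \<one>"
      using cyclesD(4-6) [OF uc] cong [OF tR] by simp_all
    \<comment> \<open>The forest leads to \<open>R\<close> within \<open>a\<close> steps, and an
      orbit never leaves \<open>R\<close> again.\<close>
    have aR: "(?t ^^ k) x \<in> R" if "x \<in> A" "a \<le> k" for x k
    proof -
      have "reaches g R a x"
      proof (cases "x \<in> R")
        case True
        then show ?thesis by (cases a) auto
      next
        case False
        then have "reaches ?v R a x" using vf that by (auto simp: forests_def)
        then show ?thesis using reaches_cong [of "A - R" g R ?v x a] t False that by auto
      qed
      then obtain i where i: "i \<le> a" "(?t ^^ i) x \<in> R" by (auto simp: reaches_iff)
      have "(?t ^^ (k - i)) ((?t ^^ i) x) \<in> R" using tgt_funpow_closed [OF tR i(2)] .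
      then show ?thesis using add [of "k - i" i x] i that by simp
    qed
    have "{x\<in>A. (?t ^^ m) x = x} = R"
    proof (intro equalityI subsetI)
      fix x assume "x \<in> {x\<in>A. (?t ^^ m) x = x}"
      \<comment> \<open>A point fixed by \<open>m\<close> steps equals its iterate after
        \<open>m * a\<close> steps, which is late enough to lie in \<open>R\<close>.\<close>
      then show "x \<in> R" using tgt_funpow_period [of m g x a] aR [of x "m * a"] le_am by auto
    qed (use per assms(1) in auto)
    moreover have "A \<noteq> {}" using uc assms(1) by (auto simp: cycles_def)
    moreover have "\<exists>k l. (?t ^^ k) x = (?t ^^ l) y" if "x \<in> A" "y \<in> A" for x y
      using cyc [OF aR aR, OF that(1) order_refl that(2) order_refl] by (metis add)
    moreover have "solves_at G a b g x" if "x \<in> A" for x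
      using solves [OF gA that] per one aR [OF that order_refl] by simp
    ultimately show ?l using conn gA by (auto simp: m_def)
  qed
qed

lemma (in group) card_conn_sols_eq_sum:
  assumes "finite A" "finite (carrier G)" "a < b"
  shows "card (conn_sols G a b A) =
    (\<Sum>R\<in>Pow A. card (cycles G (b - a) R) * card (forests G a (A - R) R))"
proof -
  let ?S = "conn_sols G a b A" and ?R = "\<lambda>g. {x\<in>A. (tgt g ^^ (b - a)) x = x}"
  have "finite ?S" using finite_sols [OF assms(1,2)] by (simp add: conn_sols_def)
  then have "card ?S = (\<Sum>R\<in>Pow A. card {g\<in>?S. ?R g = R})"
    using assms(1) by (intro card_eq_sum_fibres) auto
  also have "\<dots> = (\<Sum>R\<in>Pow A. card (cycles G (b - a) R) * card (forests G a (A - R) R))"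
    by (intro sum.cong refl card_extensional_split [OF _ _ _ _ conn_sols_split])
      (auto simp: assms conn_sols_def sols_def cycles_def forests_def PiE_iff)
  finally show ?thesis .
qed

text \<open>The series substituted into \<open>exp_restrict M\<close> in the theorem; it is the
  exponential generating function of the connected solutions with size in \<Lambda>.\<close>

definition conn_fps :: "('a, 'b) monoid_scheme \<Rightarrow> nat \<Rightarrow> nat \<Rightarrow> nat set \<Rightarrow> rat fps" where
  "conn_fps H a b \<Lambda> = fps_const (1 / of_nat (card (carrier H))) *
    (\<Sum>\<gamma> | \<gamma> dvd b - a. fps_const (inverse (of_nat \<gamma>) * of_nat (iota H ((b - a) div \<gamma>))) *
      fps_restrict (scaled_Delta (card (carrier H)) a ^ \<gamma>) \<Lambda>)"

text \<open>For a cycle of \<open>r\<close> points among \<open>n\<close>, the factorials combine to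
  \<open>fact n / r\<close>, and \<open>h ^ r\<close> times the forest coefficient is the
  coefficient of \<open>scaled_Delta h a ^ r\<close>.\<close>

lemma (in group) card_conn_sols:
  assumes "finite A" "finite (carrier G)" "a < b"
  shows "(if card A \<in> \<Lambda> then of_nat (card (conn_sols G a b A)) else 0) =
    fact (card A) * fps_nth (conn_fps G a b \<Lambda>) (card A)"
proof (cases "card A \<in> \<Lambda>")
  case False
  then show ?thesis by (simp add: conn_fps_def fps_restrict_def fps_sum_nth)
next
  case True
  define m where "m = b - a"
  have m: "0 < m" using assms(3) by (simp add: m_def)
  let ?h = "card (carrier G)" and ?n = "card A"
  let ?c = "\<lambda>r. if r dvd m then fact r / of_nat r * of_nat (iota G (m div r)) * of_nat ?h ^ r / of_nat ?h else 0 :: rat"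
  let ?f = "\<lambda>r. fact (?n - r) * fps_nth (forest_fps ?h a r) (?n - r)"
  let ?w = "\<lambda>r. inverse (of_nat r) * of_nat (iota G (m div r)) * fps_nth (scaled_Delta ?h a ^ r) ?n / of_nat ?h :: rat"
  have "(of_nat (card (conn_sols G a b A)) :: rat) = (\<Sum>R\<in>Pow A. ?c (card R) * ?f (card R))"
    unfolding card_conn_sols_eq_sum [OF assms] of_nat_sum
  proof (rule sum.cong [OF refl])
    fix R assume "R \<in> Pow A"
    then have R: "R \<subseteq> A" "finite R" using assms(1) finite_subset by auto
    then show "(of_nat (card (cycles G (b - a) R) * card (forests G a (A - R) R)) :: rat) =
        ?c (card R) * ?f (card R)"
      using card_cycles [OF assms(2) R(2) m] card_forests [of "A - R" R G a] assms
      by (auto simp: m_def card_Diff_subset)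
  qed
  also have "\<dots> = (\<Sum>r\<le>?n. of_nat (?n choose r) * (?c r * ?f r))"
    by (rule sum_Pow_card [OF assms(1), of "\<lambda>r. ?c r * ?f r"])
  also have "\<dots> = (\<Sum>r\<le>?n. if r dvd m then fact ?n * ?w r else 0)"
    by (rule sum.cong) (auto simp: scaled_Delta_power_nth binomial_fact divide_simps)
  \<comment> \<open>Divisors \<open>r\<close> larger than \<open>n\<close> may be included, because
    the \<open>r\<close>-th power has no terms of degree below \<open>r\<close>.\<close>
  also have "\<dots> = (\<Sum>r | r dvd m. fact ?n * ?w r)"
    using m by (intro sum.mono_neutral_cong) (auto simp: scaled_Delta_power_nth)
  also have "\<dots> = fact ?n * fps_nth (conn_fps G a b \<Lambda>) ?n"
    using True by (simp add: conn_fps_def m_def fps_sum_nth fps_restrict_def sum_distrib_left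
      sum_divide_distrib del: fps_const_mult)
  finally show ?thesis using True by simp
qed

lemma (in group) card_adm_sols:
  assumes "finite A" "finite (carrier G)" "a < b"
  shows "(of_nat (card (adm_sols G a b \<Lambda> k A)) :: rat) =
    fact (card A) * (fps_nth (conn_fps G a b \<Lambda> ^ k) (card A) / fact k)"
  using assms(1)
proof (induction k arbitrary: A)
  case 0
  \<comment> \<open>Only the empty set has no components, and it carries one solution, the
    everywhere undefined map.\<close>
  show ?case
  proof (cases "A = {}")
    case True
    then have "adm_sols G a b \<Lambda> 0 A = {\<lambda>_. undefined}" by (auto simp: adm_sols_def sols_def comps_def)
    then show ?thesis using True by simp
  next
    case False
    then have "adm_sols G a b \<Lambda> 0 A = {}" using 0 by (auto simp: adm_sols_def comps_def)
    then show ?thesis using False 0 by simp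
  qed
next
  case (Suc k)
  let ?C = "conn_fps G a b \<Lambda>" and ?n = "card A"
  let ?\<phi> = "\<lambda>i. fact i * fps_nth ?C i * (fact (?n - i) * (fps_nth (?C ^ k) (?n - i) / fact k)) :: rat"
  have "of_nat (Suc k) * (of_nat (card (adm_sols G a b \<Lambda> (Suc k) A)) :: rat) =
      (\<Sum>B\<in>Pow A. of_nat ((if card B \<in> \<Lambda> then card (conn_sols G a b B) else 0) *
        card (adm_sols G a b \<Lambda> k (A - B))))"
    unfolding of_nat_mult [symmetric] card_adm_sols_Suc [OF Suc.prems assms(2)] of_nat_sum ..
  also have "\<dots> = (\<Sum>B\<in>Pow A. ?\<phi> (card B))"
  proof (rule sum.cong [OF refl])
    fix B assume "B \<in> Pow A"
    then have B: "B \<subseteq> A" "finite B" using Suc.prems finite_subset by auto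
    then show "of_nat ((if card B \<in> \<Lambda> then card (conn_sols G a b B) else 0) *
        card (adm_sols G a b \<Lambda> k (A - B))) = ?\<phi> (card B)"
      using card_conn_sols [OF B(2) assms(2,3), of \<Lambda>] Suc.IH [of "A - B"] Suc.prems
      by (auto simp: card_Diff_subset)
  qed
  also have "\<dots> = (\<Sum>i\<le>?n. of_nat (?n choose i) * ?\<phi> i)"
    by (rule sum_Pow_card [OF Suc.prems])
  also have "\<dots> = (\<Sum>i\<le>?n. fact ?n / fact k * (fps_nth ?C i * fps_nth (?C ^ k) (?n - i)))"
    by (rule sum.cong) (auto simp: binomial_fact)
  also have "\<dots> = fact ?n / fact k * fps_nth (?C ^ Suc k) ?n"
    by (simp add: fps_mult_nth sum_distrib_left atMost_atLeast0)
  finally show ?case by (simp add: field_simps del: of_nat_Suc)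
qed

section \<open>The wreath product\<close>

definition merge :: "nat \<Rightarrow> (nat \<Rightarrow> 'a) \<times> (nat \<Rightarrow> nat) \<Rightarrow> nat \<Rightarrow> 'a \<times> nat" where
  "merge n X = (\<lambda>j\<in>{1..n}. (fst X j, snd X j))"

lemma carrier_wreath: "carrier (wreath H n) = ({1..n} \<rightarrow>\<^sub>E carrier H) \<times> ({1..n} \<rightarrow>\<^sub>E {1..n})"
  by (simp add: wreath_def full_transf_def)

lemma bij_betw_merge:
  "bij_betw (merge n) (carrier (wreath H n)) ({1..n} \<rightarrow>\<^sub>E carrier H \<times> {1..n})"
proof (rule bij_betw_byWitness [where f' = "\<lambda>g. (\<lambda>j\<in>{1..n}. fst (g j), \<lambda>j\<in>{1..n}. snd (g j))"])
  show "\<forall>X\<in>carrier (wreath H n).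
      (\<lambda>j\<in>{1..n}. fst (merge n X j), \<lambda>j\<in>{1..n}. snd (merge n X j)) = X"
    by (auto simp: carrier_wreath merge_def fun_eq_iff PiE_iff extensional_def)
  show "\<forall>g\<in>{1..n} \<rightarrow>\<^sub>E carrier H \<times> {1..n}.
      merge n (\<lambda>j\<in>{1..n}. fst (g j), \<lambda>j\<in>{1..n}. snd (g j)) = g"
    by (auto simp: merge_def fun_eq_iff PiE_iff extensional_def)
  show "merge n ` carrier (wreath H n) \<subseteq> {1..n} \<rightarrow>\<^sub>E carrier H \<times> {1..n}"
    by (fastforce simp: merge_def carrier_wreath PiE_iff)
  show "(\<lambda>g. (\<lambda>j\<in>{1..n}. fst (g j), \<lambda>j\<in>{1..n}. snd (g j))) ` ({1..n} \<rightarrow>\<^sub>E carrier H \<times> {1..n})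
      \<subseteq> carrier (wreath H n)"
    by (fastforce simp: carrier_wreath PiE_iff mem_Times_iff)
qed

lemma (in group) wreath_pow:
  assumes "X \<in> carrier (wreath G n)"
  shows "X [^]\<^bsub>wreath G n\<^esub> k =
    (\<lambda>j\<in>{1..n}. path_prod G (merge n X) k j, \<lambda>j\<in>{1..n}. (tgt (merge n X) ^^ k) j)"
proof (induction k)
  case 0
  show ?case by (auto simp: nat_pow_def wreath_def full_transf_def fun_eq_iff)
next
  case (Suc k)
  let ?g = "merge n X"
  obtain f \<tau> where X: "X = (f, \<tau>)" by fastforce
  have g: "?g j \<in> carrier G \<times> {1..n}" if "j \<in> {1..n}" for j
    using bij_betw_apply [OF bij_betw_merge assms] that by (rule PiE_mem)
  then have t: "tgt ?g j \<in> {1..n}" if "j \<in> {1..n}" for j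
    using that by (auto simp: tgt_def mem_Times_iff)
  \<comment> \<open>Powers in the monoid add a factor on the right, while \<open>path_prod\<close>
    and \<open>funpow\<close> recurse at the other end or on the outside; here both are put into the
    form with the last step split off.\<close>
  have 1: "path_prod G ?g (Suc k) j = path_prod G ?g k j \<otimes> f ((tgt ?g ^^ k) j)"
    and 2: "(tgt ?g ^^ Suc k) j = \<tau> ((tgt ?g ^^ k) j)"
    if j: "j \<in> {1..n}" for j
  proof -
    have i: "(tgt ?g ^^ k) j \<in> {1..n}" by (rule tgt_funpow_closed [OF t j])
    then have "fst (?g ((tgt ?g ^^ k) j)) = f ((tgt ?g ^^ k) j)" "f ((tgt ?g ^^ k) j) \<in> carrier G"
      using assms by (auto simp: merge_def X carrier_wreath)
    then show "path_prod G ?g (Suc k) j = path_prod G ?g k j \<otimes> f ((tgt ?g ^^ k) j)"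
      using path_prod_add [of "{1..n}" ?g j k 1, OF g j] by simp
    show "(tgt ?g ^^ Suc k) j = \<tau> ((tgt ?g ^^ k) j)"
      using i by (simp add: tgt_def merge_def X)
  qed
  have "X [^]\<^bsub>wreath G n\<^esub> Suc k = X [^]\<^bsub>wreath G n\<^esub> k \<otimes>\<^bsub>wreath G n\<^esub> X"
    by (simp add: nat_pow_def)
  also have "\<dots> = (\<lambda>j\<in>{1..n}. path_prod G ?g k j \<otimes> f ((tgt ?g ^^ k) j),
      \<lambda>j\<in>{1..n}. \<tau> ((tgt ?g ^^ k) j))"
    unfolding Suc by (simp add: wreath_def full_transf_def X cong: restrict_cong)
  also have "\<dots> = (\<lambda>j\<in>{1..n}. path_prod G ?g (Suc k) j, \<lambda>j\<in>{1..n}. (tgt ?g ^^ Suc k) j)"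
    by (intro arg_cong2 [where f = Pair] restrict_ext) (simp_all only: 1 2)
  finally show ?case .
qed

text \<open>By \<open>equivclp_transf_iff\<close>, weak connectedness means that forward orbits
  merge, and iterates of \<open>snd X\<close> and of the merged map agree on
  \<open>{1..n}\<close>.\<close>

lemma transf_components_eq_comps:
  assumes "X \<in> carrier (wreath H n)"
  shows "transf_components n (snd X) = comps {1..n} (merge n X)"
proof -
  let ?\<tau> = "snd X" and ?g = "merge n X"
  have \<tau>: "?\<tau> \<in> {1..n} \<rightarrow> {1..n}" using assms by (auto simp: carrier_wreath)
  have pow: "(?\<tau> ^^ k) j = (tgt ?g ^^ k) j \<and> (tgt ?g ^^ k) j \<in> {1..n}" if "j \<in> {1..n}" for j k
    using that \<tau> by (induction k) (auto simp: tgt_def merge_def Pi_iff)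
  have "{(i, j). i \<in> {1..n} \<and> j \<in> {1..n} \<and> equivclp (\<lambda>a b. a \<in> {1..n} \<and> b = ?\<tau> a) i j} `` {i}
      = comp_of {1..n} ?g i" if "i \<in> {1..n}" for i
  proof -
    have "equivclp (\<lambda>a b. a \<in> {1..n} \<and> b = ?\<tau> a) i j \<longleftrightarrow> (\<exists>k l. (tgt ?g ^^ k) i = (tgt ?g ^^ l) j)"
      if "j \<in> {1..n}" for j
      unfolding equivclp_transf_iff [OF \<tau> \<open>i \<in> {1..n}\<close> that]
      using pow [OF \<open>i \<in> {1..n}\<close>] pow [OF that] by simp
    then show ?thesis using that by (auto simp: comp_of_def)
  qed
  then show ?thesis
    unfolding transf_components_def comps_def quotient_def by blast
qed

text \<open>\<open>merge\<close> carries the solutions bijectively to single maps, which are then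
  sorted by their number of components. This is at most \<open>n\<close>, as each component is the
  class of one of \<open>n\<close> points.\<close>

lemma (in group) num_solutions_eq_sum:
  assumes "finite (carrier G)"
  shows "num_solutions G a b \<Lambda> M n =
    (\<Sum>k\<le>n. if k \<in> M then card (adm_sols G a b \<Lambda> k {1..n}) else 0)"
proof -
  let ?A = "{1..n}"
  let ?S = "{g \<in> sols G a b ?A. (\<forall>C\<in>comps ?A g. card C \<in> \<Lambda>) \<and> card (comps ?A g) \<in> M}"
  have iff: "X [^]\<^bsub>wreath G n\<^esub> a = X [^]\<^bsub>wreath G n\<^esub> b \<and> admissible \<Lambda> M n (snd X) \<longleftrightarrow> merge n X \<in> ?S"
    if X: "X \<in> carrier (wreath G n)" for X
  proof -
    have "X [^]\<^bsub>wreath G n\<^esub> a = X [^]\<^bsub>wreath G n\<^esub> b \<longleftrightarrow> (\<forall>j\<in>?A. solves_at G a b (merge n X) j)"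
      unfolding wreath_pow [OF X] solves_at_def by (auto simp: fun_eq_iff restrict_def)
    also have "\<dots> \<longleftrightarrow> merge n X \<in> sols G a b ?A"
      using bij_betw_apply [OF bij_betw_merge X] by (simp add: sols_def)
    finally show ?thesis
      unfolding admissible_def transf_components_eq_comps [OF X] by simp
  qed
  have "bij_betw (merge n)
      {X \<in> carrier (wreath G n). X [^]\<^bsub>wreath G n\<^esub> a = X [^]\<^bsub>wreath G n\<^esub> b \<and> admissible \<Lambda> M n (snd X)}
      ?S"
  proof (rule bij_betw_subset [OF bij_betw_merge])
    show "merge n ` {X \<in> carrier (wreath G n). X [^]\<^bsub>wreath G n\<^esub> a = X [^]\<^bsub>wreath G n\<^esub> b \<and>
        admissible \<Lambda> M n (snd X)} = ?S"
    proof (intro equalityI subsetI)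
      fix g assume g: "g \<in> ?S"
      then have "g \<in> ?A \<rightarrow>\<^sub>E carrier G \<times> ?A" by (simp add: sols_def)
      then obtain X where "X \<in> carrier (wreath G n)" "g = merge n X"
        using bij_betw_imp_surj_on [OF bij_betw_merge] by blast
      then show "g \<in> merge n ` {X \<in> carrier (wreath G n).
          X [^]\<^bsub>wreath G n\<^esub> a = X [^]\<^bsub>wreath G n\<^esub> b \<and> admissible \<Lambda> M n (snd X)}"
        using iff g by blast
    qed (use iff in blast)
  qed auto
  from bij_betw_same_card [OF this] have "num_solutions G a b \<Lambda> M n = card ?S"
    by (simp add: num_solutions_def)
  also have "\<dots> = (\<Sum>k\<le>n. card {g \<in> ?S. card (comps ?A g) = k})"
  proof (rule card_eq_sum_fibres)
    show "finite ?S" using finite_sols [of ?A G a b] assms by simp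
    show "(\<lambda>g. card (comps ?A g)) ` ?S \<subseteq> {..n}"
      using card_image_le [of ?A] by (auto simp: comps_def)
  qed simp
  also have "\<dots> = (\<Sum>k\<le>n. if k \<in> M then card (adm_sols G a b \<Lambda> k {1..n}) else 0)"
  proof (rule sum.cong [OF refl])
    fix k
    have "{g \<in> ?S. card (comps ?A g) = k} = (if k \<in> M then adm_sols G a b \<Lambda> k ?A else {})"
      by (auto simp: adm_sols_def)
    then show "card {g \<in> ?S. card (comps ?A g) = k} = (if k \<in> M then card (adm_sols G a b \<Lambda> k ?A) else 0)"
      by (cases "k \<in> M") (simp_all only: if_True if_False card.empty)
  qed
  finally show ?thesis .
qed

theorem theorem1:
  fixes H :: "('a, 'b) monoid_scheme"
    and \<alpha> \<beta> :: nat
    and \<Lambda> M :: "nat set"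
  assumes "Group.group H"
    and "finite (carrier H)"
    and "\<alpha> < \<beta>"
    and "0 \<notin> \<Lambda>"
  shows "Abs_fps (\<lambda>n. of_nat (num_solutions H \<alpha> \<beta> \<Lambda> M n) / fact n) =
    exp_restrict M oo
      (fps_const (1 / of_nat (card (carrier H))) *
        (\<Sum>\<gamma> | \<gamma> dvd \<beta> - \<alpha>.
          fps_const (inverse (of_nat \<gamma>) * of_nat (iota H ((\<beta> - \<alpha>) div \<gamma>))) *
          fps_restrict ((Delta \<alpha> oo (fps_const (of_nat (card (carrier H))) * fps_X)) ^ \<gamma>) \<Lambda>))"
proof (rule fps_ext)
  fix n
  interpret group H by fact
  let ?C = "conn_fps H \<alpha> \<beta> \<Lambda>"
  have "(of_nat (num_solutions H \<alpha> \<beta> \<Lambda> M n) :: rat) =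
      (\<Sum>k\<le>n. fact n * (if k \<in> M then fps_nth (?C ^ k) n / fact k else 0))"
    unfolding num_solutions_eq_sum [OF assms(2)] of_nat_sum
    using card_adm_sols [of "{1..n}" \<alpha> \<beta> \<Lambda>] assms(2,3) by (intro sum.cong) auto
  \<comment> \<open>The coefficient of degree \<open>n\<close> of a composition is a sum over
    \<open>k \<le> n\<close>, the same range as for the number of components.\<close>
  also have "\<dots> = fact n * fps_nth (exp_restrict M oo ?C) n"
    by (auto simp: fps_compose_nth exp_restrict_def fps_restrict_def sum_distrib_left atMost_atLeast0
        intro!: sum.cong)
  finally show "fps_nth (Abs_fps (\<lambda>n. of_nat (num_solutions H \<alpha> \<beta> \<Lambda> M n) / fact n)) n =
    fps_nth (exp_restrict M oo
      (fps_const (1 / of_nat (card (carrier H))) *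
        (\<Sum>\<gamma> | \<gamma> dvd \<beta> - \<alpha>.
          fps_const (inverse (of_nat \<gamma>) * of_nat (iota H ((\<beta> - \<alpha>) div \<gamma>))) *
          fps_restrict ((Delta \<alpha> oo (fps_const (of_nat (card (carrier H))) * fps_X)) ^ \<gamma>) \<Lambda>))) n"
    by (simp add: conn_fps_def)
qed

end
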